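(* Consider the trivial quantum principal $\mathcal U(1)$-bundle $\zeta=(\mathbb T^n_\Xi\otimes G,\mathbb T^n_\Xi,\mathrm{id}\otimes\Delta)$ over the quantum $n$-torus ($n\ge2$), with the differential calculus built from the $1$-dimensional non-standard $*$-FODC of $U(1)$ as described in the context. Let $\omega$ be a quantum principal connection different from $\omega^c$, and write $\omega=\omega^c+\lambda$ with $\lambda(\vartheta)=\mu\otimes\mathbf 1$, $\mu\in\Omega^1(\mathbb T^n_\Xi)$, $\mu^*=\mu$ (so $R^\omega(\vartheta)=(d\mu+\mu\,\mu)\otimes\mathbf 1$). Then $\omega$ is a Yang–Mills quantum principal connection if and only if $$d(\star_q(d\mu+\mu\,\mu))+\mu\,\star_q(d\mu+\mu\,\mu)+(-1)^{n-1}\star_q(d\mu+\mu\,\mu)\,\mu=0 .$$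
   Context: All graded $*$-algebras satisfy $(ab)^*=(-1)^{kl}b^*a^*$ for degrees $k,l$, and $d(a^* )=-(da)^*$. **Quantum torus.** Fix $n\ge2$ and a real antisymmetric $n\times n$ matrix $\Xi$. $\mathbb T^n_\Xi$ is the $*$-algebra of formal sums $\sum a_{k_1\cdots k_n}u_1^{k_1}\cdots u_n^{k_n}$ with rapidly decaying coefficients, $u_k^*=u_k^{-1}$, $u_ku_j=e^{2\pi i\Xi_{kj}}u_ju_k$. $\delta_j$ is the derivation with $\delta_j(u_k)=2\pi i\,u_j$ if $k=j$, $0$ otherwise. $\Omega^\bullet(\mathbb T^n_\Xi)=\mathbb T^n_\Xi\otimes\bigwedge^\bullet\mathbb C^n$ with $(x_1\otimes v_1)(x_2\otimes v_2)=x_1x_2\otimes v_1\wedge v_2$, $(x\otimes v)^*=x^*\otimes v^*$ ($v^*$ complex conjugation in the canonical basis $\bar e_j$), $d\mathbb U_j:=\mathbf 1\otimes\bar e_j$, $dx=i\sum_j\delta_j(x)\,d\mathbb U_j$, $d(x\,d\mathbb U_{j_1}\cdots d\mathbb U_{j_k})=dx\,d\mathbb U_{j_1}\cdots d\mathbb U_{j_k}$. $\star_q(x\otimes v)=x\otimes\star v$ with $\star$ the Hodge operator of $\bigwedge^\bullet\mathbb C^n$; $\int_{\mathbb T^n_\Xi}x\,d\mathbb U_1\cdots d\mathbb U_n=\mathrm{Tr}_w(x|\mathcal D|^{-n})$ (Dixmier trace for the canonical spectral triple of $\mathbb T^n_\Xi$; a positive multiple of the canonical trace $\tau_0(x)=a_{0\cdots0}$);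 $\langle\mu_1\mid\mu_2\rangle_{\mathrm R}=\int_{\mathbb T^n_\Xi}\mu_1^*\star_q\mu_2$ for equal degrees, $0$ otherwise. **Calculus on $U(1)$.** $G=\mathbb C[z,z^{-1}]$, $z^*=z^{-1}$, $\Delta(z^k)=z^k\otimes z^k$. The non-standard $*$-FODC is defined by the ideal $\mathcal R=(z^2-\mathbf 1)G\subset\mathrm{Ker}(\epsilon)$: $\mathfrak{qu}(1)^\#=\mathrm{Ker}(\epsilon)/\mathcal R=\mathbb C\vartheta$, $\vartheta=\pi(z)=z^*dz$ (norm $1$), $\pi(z^{2k+1})=\vartheta$, $\pi(z^{2k})=0$, $dg=g^{(1)}\pi(g^{(2)})$. Its universal differential envelope is $\Gamma^\wedge=G\otimes\mathbb C[\vartheta]$ (all powers of $\vartheta$ non-zero), $\vartheta z=-z\vartheta$, $\vartheta^*=\vartheta$, $d\vartheta=-\vartheta\vartheta$, and $\Delta$ extends to $\Gamma^\wedge$ with $\Delta(\vartheta)=\mathbf 1\otimes\vartheta+\vartheta\otimes\mathbf 1$. $\mathrm{ad}(\vartheta)=\vartheta\otimes\mathbf 1$. The embedded differential used is $\Theta(\vartheta)=-\vartheta\otimes\vartheta$. **Bundle.** $P=\mathbb T^n_\Xi\otimes G$, $\Delta_P=\mathrm{id}\otimes\Delta$, $\Omega^\bullet(P)=\Omega^\bullet(\mathbb T^n_\Xi)\otimes\Gamma^\wedge$ (graded tensor product of graded differential $*$-algebras), $\Delta_{\Omega^\bullet(P)}=\mathrm{id}\otimes\Delta$; horizontal forms $\Omega^\bullet(\mathbb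 T^n_\Xi)\otimes G$, base forms $\Omega^\bullet(\mathbb T^n_\Xi)\otimes\mathbf 1\cong\Omega^\bullet(\mathbb T^n_\Xi)$. **Connections.** A quantum principal connection is a linear map $\omega:\mathfrak{qu}(1)^\#\to\Omega^1(P)$ with $\Delta_{\Omega^\bullet(P)}(\omega(\theta))=(\omega\otimes\mathrm{id})\mathrm{ad}(\theta)+\mathbf 1\otimes\theta$ and $\omega(\theta^* )=\omega(\theta)^*$. One is $\omega^c(\vartheta)=\mathbf 1\otimes\vartheta$, and every one is $\omega^c+\lambda$ with $\lambda(\vartheta)=\mu\otimes\mathbf 1$, $\mu=\mu^*\in\Omega^1(\mathbb T^n_\Xi)$. With $\langle T_1,T_2\rangle(\vartheta)=-T_1(\vartheta)T_2(\vartheta)$ (i.e. product composed with $T_1\otimes T_2$ and $\Theta$), the curvature is $R^\omega=d\omega-\langle\omega,\omega\rangle$. **Yang–Mills equation.** $\mathrm{Mor}(\mathrm{ad},\Delta_{\mathrm{Hor}})$ consists of linear $\tau:\mathbb C\vartheta\to\Omega^\bullet(\mathbb T^n_\Xi)\otimes\mathbf 1$; $E=\mathrm{Mor}(\mathrm{ad},\Delta_P)$ is its degree $0$ part, with $\langle T_1,T_2\rangle_{\mathrm R}=T_1(\vartheta)^*T_2(\vartheta)$; $\widehat\Upsilon:\mathrm{Mor}(\mathrm{ad},\Delta_{\mathrm{Hor}})\to E\otimes_{\mathbb T^n_\Xi}\Omega^\bullet(\mathbb T^n_\Xi)$ has inverse $T\otimes\nu\mapsto T\nu$; $\langle T_1\otimes\mu_1\mid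 T_2\otimes\mu_2\rangle^\bullet_{\mathrm R}=\langle\mu_1\mid\langle T_1,T_2\rangle_{\mathrm R}\mu_2\rangle_{\mathrm R}$. For $\tau$ with values in degree $k$, $DS^\omega(\tau)=d\tau-\langle\omega,\tau\rangle+(-1)^k\langle\tau,\omega\rangle$; $\widehat{DS}^\omega=\wedge\circ DS^\omega\circ\wedge$ with $\wedge(\tau)=*\circ\tau\circ*$; $d^{\widehat{DS}^\omega}=\widehat\Upsilon\circ\widehat{DS}^\omega\circ\widehat\Upsilon^{-1}$; $d^{\widehat{DS}^\omega\star}$ is its formal adjoint for $\langle-|-\rangle^\bullet_{\mathrm R}$. $\omega$ is a Yang–Mills quantum principal connection if $d^{\widehat{DS}^\omega\star}(\widehat\Upsilon(R^\omega))=0$ (non-commutative geometrical Yang–Mills equation). *)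

theory Defs
  imports
    "HOL-Analysis.Analysis"
    "HOL-Library.Poly_Mapping"
    "HOL-Algebra.Free_Abelian_Groups"
begin

section \<open>The quantum torus\<close>

text \<open>
  The index type \<open>'n\<close> plays the role of \<open>{1, \<dots>, n}\<close>. An element is the family of coefficients of
  \<open>\<Sum>\<^sub>k a\<^sub>k u\<^sup>k\<close>, where \<open>u\<^sup>k\<close> is the product of the \<open>u\<^sub>j\<close> raised to \<open>k\<^sub>j\<close>, taken in increasing order of \<open>j\<close>.
\<close>

definition l1norm :: "int ^ 'n::finite \<Rightarrow> real"
  where "l1norm k = (\<Sum>j\<in>UNIV. \<bar>real_of_int (k $ j)\<bar>)"

definition rapidly_decaying :: "(int ^ 'n::finite \<Rightarrow> complex) \<Rightarrow> bool"
  where "rapidly_decaying a \<longleftrightarrow> (\<forall>p::nat. \<exists>C. \<forall>k. (1 + l1norm k) ^ p * cmod (a k) \<le> C)"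

lemma l1norm_nonneg: "0 \<le> l1norm k"
  by (simp add: l1norm_def sum_nonneg)

lemma l1norm_triangle: "l1norm (k + l) \<le> l1norm k + l1norm l"
  unfolding l1norm_def sum.distrib[symmetric] by (intro sum_mono) auto

lemma l1norm_minus: "l1norm (- k) = l1norm k"
  by (simp add: l1norm_def)

lemma one_plus_l1norm_split: "1 + l1norm m \<le> (1 + l1norm k) * (1 + l1norm (m - k))"
proof -
  have "l1norm m \<le> l1norm k + l1norm (m - k)"
    using l1norm_triangle[of k "m - k"] by simp
  moreover have "0 \<le> l1norm k * l1norm (m - k)"
    by (simp add: l1norm_nonneg)
  ultimately show ?thesis by (simp add: algebra_simps)
qed

lemma summable_int_inverse_square:
  "(\<lambda>i::int. 1 / (1 + \<bar>real_of_int i\<bar>) ^ 2) summable_on UNIV"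
proof -
  let ?f = "\<lambda>i::int. 1 / (1 + \<bar>real_of_int i\<bar>) ^ 2"
  have s: "summable (\<lambda>n::nat. 1 / (1 + real n) ^ 2)"
    using summable_Suc_iff[of "\<lambda>n. inverse (real n ^ 2)"] inverse_power_summable[of 2, where 'a=real]
    by (simp add: field_simps)
  then have s2: "(\<lambda>n::nat. 1 / (1 + real n) ^ 2) summable_on UNIV"
    by (intro norm_summable_imp_summable_on) simp
  have 1: "?f summable_on (range int)"
    by (subst summable_on_reindex) (use s2 in \<open>auto simp: o_def\<close>)
  have 2: "?f summable_on (range (\<lambda>n. - int n))"
    by (subst summable_on_reindex) (use s2 in \<open>auto simp: o_def inj_on_def\<close>)
  have "UNIV = range int \<union> range (\<lambda>n. - int n)"
    using int_cases2 by blast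
  then show ?thesis
    using summable_on_union[OF 1 2] by metis
qed

lemma summable_l1norm:
  "(\<lambda>k::int ^ 'n::finite. 1 / (1 + l1norm k) ^ (2 * CARD('n))) summable_on UNIV"
proof -
  let ?h = "\<lambda>i::int. 1 / (1 + \<bar>real_of_int i\<bar>) ^ 2"
  let ?F = "\<lambda>g::'n \<Rightarrow> int. \<Prod>j\<in>UNIV. ?h (g j)"
  have a: "Infinite_Set_Sum.abs_summable_on ?h UNIV"
    using summable_int_inverse_square unfolding abs_summable_equivalent[symmetric]
    by (simp add: abs_summable_equivalent)
  have "Infinite_Set_Sum.abs_summable_on ?F (PiE UNIV (\<lambda>_. UNIV))"
    by (rule abs_summable_on_prod_PiE) (use a in auto)
  moreover have "PiE (UNIV :: 'n set) (\<lambda>_. UNIV :: int set) = UNIV"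
    by auto
  ultimately have "?F summable_on UNIV"
    by (metis abs_summable_equivalent abs_summable_summable)
  moreover have "bij (vec_nth :: int ^ 'n \<Rightarrow> 'n \<Rightarrow> int)"
    by (metis bijI' vec_lambda_inverse vec_nth_inject UNIV_I)
  ultimately have "(?F \<circ> vec_nth) summable_on (UNIV :: (int ^ 'n) set)"
    by (metis bij_is_inj bij_is_surj summable_on_reindex)
  then show ?thesis
  proof (rule summable_on_comparison_test)
    fix k :: "int ^ 'n"
    have "(\<Prod>j\<in>UNIV. (1 + \<bar>real_of_int (k $ j)\<bar>) ^ 2) \<le> (\<Prod>j\<in>(UNIV::'n set). (1 + l1norm k) ^ 2)"
      by (intro prod_mono conjI power_mono)
         (auto simp: l1norm_def intro!: member_le_sum)
    also have "\<dots> = (1 + l1norm k) ^ (2 * CARD('n))"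
      by (simp add: power_mult)
    finally have le: "(\<Prod>j\<in>UNIV. (1 + \<bar>real_of_int (k $ j)\<bar>) ^ 2) \<le> (1 + l1norm k) ^ (2 * CARD('n))" .
    have pos: "0 < (\<Prod>j\<in>UNIV. (1 + \<bar>real_of_int (k $ j)\<bar>) ^ 2)"
      by (intro prod_pos) (simp add: add_pos_nonneg)
    show "1 / (1 + l1norm k) ^ (2 * CARD('n)) \<le> (?F \<circ> vec_nth) k"
      using frac_le[OF _ order_refl pos le, of 1]
      by (simp add: prod_dividef)
    show "0 \<le> 1 / (1 + l1norm k) ^ (2 * CARD('n))"
      using l1norm_nonneg[of k] by simp
  qed
qed

lemma rapidly_decaying_convolution:
  fixes a b :: "int ^ 'n::finite \<Rightarrow> complex"
  assumes "rapidly_decaying a" "rapidly_decaying b" and c: "\<And>k m. cmod (c k m) = 1"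
  shows "rapidly_decaying (\<lambda>m. \<Sum>\<^sub>\<infinity>k. c k m * a k * b (m - k))"
  unfolding rapidly_decaying_def
proof
  fix p
  let ?N = "2 * CARD('n)"
  obtain A where A: "\<And>k. (1 + l1norm k) ^ (p + ?N) * cmod (a k) \<le> A"
    using assms(1) unfolding rapidly_decaying_def by metis
  obtain B where B: "\<And>k. (1 + l1norm k) ^ p * cmod (b k) \<le> B"
    using assms(2) unfolding rapidly_decaying_def by metis
  let ?g = "\<lambda>k::int ^ 'n. 1 / (1 + l1norm k) ^ ?N"
  show "\<exists>C. \<forall>m. (1 + l1norm m) ^ p * cmod (\<Sum>\<^sub>\<infinity>k. c k m * a k * b (m - k)) \<le> C"
  proof (intro exI allI)
    fix m :: "int ^ 'n"
    let ?f = "\<lambda>k. of_real ((1 + l1norm m) ^ p) * (c k m * a k * b (m - k))"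
    have b0: "norm (?f k) \<le> A * B * ?g k" for k
    proof -
      have pos: "0 < 1 + l1norm x" for x :: "int ^ 'n"
        using l1norm_nonneg[of x] by simp
      have "norm (?f k) = (1 + l1norm m) ^ p * cmod (a k) * cmod (b (m - k))"
        using pos[of m] by (simp add: norm_mult c norm_power flip: of_real_power)
      also have "\<dots> \<le> ((1 + l1norm k) * (1 + l1norm (m - k))) ^ p * cmod (a k) * cmod (b (m - k))"
        by (intro mult_right_mono power_mono one_plus_l1norm_split) (use pos[of m] in auto)
      also have "\<dots> = ((1 + l1norm k) ^ (p + ?N) * cmod (a k)) * ((1 + l1norm (m - k)) ^ p * cmod (b (m - k))) * ?g k"
        using pos[of k] by (simp add: power_mult_distrib power_add)
      also have "\<dots> \<le> A * B * ?g k"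
        by (intro mult_right_mono mult_mono A B order_trans[OF _ A])
           (use pos in \<open>auto intro!: mult_nonneg_nonneg zero_le_power simp: less_imp_le\<close>)
      finally show ?thesis .
    qed
    have sg: "(\<lambda>k. A * B * ?g k) summable_on UNIV"
      by (intro summable_on_cmult_right summable_l1norm)
    have sn: "(\<lambda>k. norm (?f k)) summable_on UNIV"
      by (rule summable_on_comparison_test[OF sg]) (use b0 in auto)
    have "(1 + l1norm m) ^ p * cmod (\<Sum>\<^sub>\<infinity>k. c k m * a k * b (m - k))
        = cmod (infsum ?f UNIV)"
      using l1norm_nonneg[of m] 
      by (simp only: infsum_cmult_right' norm_mult norm_of_real) simp
    also have "\<dots> \<le> (\<Sum>\<^sub>\<infinity>k. norm (?f k))"
      by (rule norm_infsum_bound) (use sn in simp)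
    also have "\<dots> \<le> (\<Sum>\<^sub>\<infinity>k. A * B * ?g k)"
      by (rule infsum_mono[OF sn sg b0])
    finally show "(1 + l1norm m) ^ p * cmod (\<Sum>\<^sub>\<infinity>k. c k m * a k * b (m - k)) \<le> (\<Sum>\<^sub>\<infinity>k. A * B * ?g k)" .
  qed
qed

typedef ('n::finite) qtorus = "{a :: int ^ 'n \<Rightarrow> complex. rapidly_decaying a}"
  morphisms coeffs Abs_qtorus
  by (rule exI[of _ "\<lambda>_. 0"]) (auto simp: rapidly_decaying_def)

type_synonym 'n lattice = "(int, 'n) vec"
type_synonym 'n rmatrix = "((real, 'n) vec, 'n) vec"

setup_lifting type_definition_qtorus

lemma rapidly_decaying_dominated:
  assumes "rapidly_decaying a" "\<And>k. cmod (b k) \<le> D * (1 + l1norm k) ^ q * cmod (a k)" "0 \<le> D"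
  shows "rapidly_decaying b"
  unfolding rapidly_decaying_def
proof
  fix p
  obtain C where C: "\<And>k. (1 + l1norm k) ^ (p + q) * cmod (a k) \<le> C"
    using assms(1) unfolding rapidly_decaying_def by metis
  have "(1 + l1norm k) ^ p * cmod (b k) \<le> D * C" for k
  proof -
    have "(1 + l1norm k) ^ p * cmod (b k) \<le> (1 + l1norm k) ^ p * (D * (1 + l1norm k) ^ q * cmod (a k))"
      by (intro mult_left_mono assms(2)) (simp add: l1norm_nonneg)
    also have "\<dots> = D * ((1 + l1norm k) ^ (p + q) * cmod (a k))"
      by (simp add: power_add)
    also have "\<dots> \<le> D * C"
      by (intro mult_left_mono C assms(3))
    finally show ?thesis .
  qed
  then show "\<exists>C. \<forall>k. (1 + l1norm k) ^ p * cmod (b k) \<le> C"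
    by blast
qed

lemma rapidly_decaying_add:
  assumes "rapidly_decaying a" "rapidly_decaying b"
  shows "rapidly_decaying (\<lambda>k. a k + b k)"
  unfolding rapidly_decaying_def
proof
  fix p
  obtain A B where A: "\<And>k. (1 + l1norm k) ^ p * cmod (a k) \<le> A"
    and B: "\<And>k. (1 + l1norm k) ^ p * cmod (b k) \<le> B"
    using assms unfolding rapidly_decaying_def by metis
  have "(1 + l1norm k) ^ p * cmod (a k + b k) \<le> A + B" for k
  proof -
    have "(1 + l1norm k) ^ p * cmod (a k + b k) \<le> (1 + l1norm k) ^ p * (cmod (a k) + cmod (b k))"
      by (intro mult_left_mono norm_triangle_ineq) (simp add: l1norm_nonneg)
    also have "\<dots> \<le> A + B"
      using A[of k] B[of k] by (simp add: distrib_left)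
    finally show ?thesis .
  qed
  then show "\<exists>C. \<forall>k. (1 + l1norm k) ^ p * cmod (a k + b k) \<le> C"
    by blast
qed

lemma rapidly_decaying_cmult:
  "rapidly_decaying a \<Longrightarrow> rapidly_decaying (\<lambda>k. c * a k)"
  by (rule rapidly_decaying_dominated[of a _ "cmod c" 0]) (auto simp: norm_mult)

instantiation qtorus :: (finite) ab_group_add
begin

lift_definition zero_qtorus :: "'a qtorus" is "\<lambda>_. 0"
  by (auto simp: rapidly_decaying_def)

lift_definition plus_qtorus :: "'a qtorus \<Rightarrow> 'a qtorus \<Rightarrow> 'a qtorus" is "\<lambda>a b k. a k + b k"
  by (rule rapidly_decaying_add)

lift_definition uminus_qtorus :: "'a qtorus \<Rightarrow> 'a qtorus" is "\<lambda>a k. - a k"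
  using rapidly_decaying_cmult[of _ "-1"] by simp

lift_definition minus_qtorus :: "'a qtorus \<Rightarrow> 'a qtorus \<Rightarrow> 'a qtorus" is "\<lambda>a b k. a k - b k"
  using rapidly_decaying_add[OF _ rapidly_decaying_cmult[of _ "-1"]] by simp

instance
  by standard (transfer; simp add: fun_eq_iff)+

end

lift_definition scaleT :: "complex \<Rightarrow> 'n::finite qtorus \<Rightarrow> 'n qtorus" is "\<lambda>c a k. c * a k"
  by (rule rapidly_decaying_cmult)

lift_definition oneT :: "'n::finite qtorus" is "\<lambda>k. if k = 0 then 1 else 0"
  unfolding rapidly_decaying_def
proof
  show "\<exists>C. \<forall>k. (1 + l1norm k) ^ p * cmod (if k = 0 then 1 else 0) \<le> C" for p
    by (rule exI[of _ 1]) (simp add: l1norm_def)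
qed

text \<open>
  Moving each \<open>u\<^sub>j\<close> of \<open>u\<^sup>l\<close> to the left of each \<open>u\<^sub>i\<close> of \<open>u\<^sup>k\<close> with \<open>i > j\<close>, by means of
  \<open>u\<^sub>i u\<^sub>j = exp (2 \<pi> \<i> \<Xi>\<^sub>i\<^sub>j) u\<^sub>j u\<^sub>i\<close>, gives \<open>u\<^sup>k u\<^sup>l = reorder \<Xi> k l u\<^sup>k\<^sup>+\<^sup>l\<close>. In the same way the product of
  the \<open>u\<^sub>j\<close> raised to \<open>-k\<^sub>j\<close> in decreasing order, which is the adjoint of \<open>u\<^sup>k\<close>, is
  \<open>reorder \<Xi> k k u\<^sup>-\<^sup>k\<close>.
\<close>

definition reorder :: "'n::{finite,linorder} rmatrix \<Rightarrow> 'n lattice \<Rightarrow> 'n lattice \<Rightarrow> complex"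
  where "reorder \<Xi> k l =
    exp (2 * of_real pi * \<i> * of_real (\<Sum>i\<in>UNIV. \<Sum>j | j < i. \<Xi> $ i $ j * real_of_int (k $ i) * real_of_int (l $ j)))"

lemma norm_reorder: "cmod (reorder \<Xi> k l) = 1"
  by (simp add: reorder_def)

lift_definition multT :: "'n::{finite,linorder} rmatrix \<Rightarrow> 'n qtorus \<Rightarrow> 'n qtorus \<Rightarrow> 'n qtorus"
  is "\<lambda>\<Xi> a b m. \<Sum>\<^sub>\<infinity>k. reorder \<Xi> k (m - k) * a k * b (m - k)"
  by (rule rapidly_decaying_convolution) (simp_all add: norm_reorder)

lift_definition starT :: "'n::{finite,linorder} rmatrix \<Rightarrow> 'n qtorus \<Rightarrow> 'n qtorus"
  is "\<lambda>\<Xi> a m. reorder \<Xi> (- m) (- m) * cnj (a (- m))"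
proof -
  show "rapidly_decaying (\<lambda>m. reorder \<Xi> (- m) (- m) * cnj (a (- m)))"
    if "rapidly_decaying a" for \<Xi> :: "'n rmatrix" and a
  proof -
    have "rapidly_decaying (\<lambda>m. a (- m))"
      using that unfolding rapidly_decaying_def by (metis l1norm_minus)
    then show ?thesis
      by (rule rapidly_decaying_dominated[of _ _ 1 0]) (auto simp: norm_mult norm_reorder)
  qed
qed

lift_definition derivT :: "'n::finite \<Rightarrow> 'n qtorus \<Rightarrow> 'n qtorus"
  is "\<lambda>j a k. 2 * of_real pi * \<i> * of_int (k $ j) * a k"
proof -
  fix j :: 'n and a :: "'n lattice \<Rightarrow> complex"
  assume a: "rapidly_decaying a"
  show "rapidly_decaying (\<lambda>k. 2 * of_real pi * \<i> * of_int (k $ j) * a k)"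
  proof (rule rapidly_decaying_dominated[OF a, of _ "2 * pi" 1])
    fix k :: "int ^ 'n"
    have "\<bar>real_of_int (k $ j)\<bar> \<le> l1norm k"
      unfolding l1norm_def by (rule member_le_sum) auto
    then show "cmod (2 * of_real pi * \<i> * of_int (k $ j) * a k) \<le> 2 * pi * (1 + l1norm k) ^ 1 * cmod (a k)"
      by (auto simp: norm_mult intro!: mult_right_mono)
  qed simp
qed

lift_definition tau0 :: "'n::finite qtorus \<Rightarrow> complex" is "\<lambda>a. a 0" .

section \<open>Differential forms on the quantum torus\<close>

text \<open>
  The coordinate of a form at \<open>I\<close> is the coefficient of the product of the \<open>d\<U>\<^sub>i\<close>, \<open>i \<in> I\<close>, taken in
  increasing order.
\<close>

type_synonym 'n form = "('n qtorus, 'n set) vec"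

definition fscale :: "complex \<Rightarrow> 'n::finite form \<Rightarrow> 'n form"
  where "fscale c \<alpha> = (\<chi> I. scaleT c (\<alpha> $ I))"

definition form_part :: "nat \<Rightarrow> 'n::finite form \<Rightarrow> 'n form"
  where "form_part k \<alpha> = (\<chi> I. if card I = k then \<alpha> $ I else 0)"

definition scalar_form :: "'n::finite qtorus \<Rightarrow> 'n form"
  where "scalar_form a = (\<chi> I. if I = {} then a else 0)"

text \<open>For disjoint \<open>I\<close>, \<open>J\<close>: the wedge product of the basis elements of \<open>I\<close> and \<open>J\<close> is this sign times the one of \<open>I \<union> J\<close>.\<close>

definition shuffle_sign :: "'n::{finite,linorder} set \<Rightarrow> 'n set \<Rightarrow> complex"
  where "shuffle_sign I J = (- 1) ^ card {(i, j). i \<in> I \<and> j \<in> J \<and> j < i}"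

definition fmult :: "'n::{finite,linorder} rmatrix \<Rightarrow> 'n form \<Rightarrow> 'n form \<Rightarrow> 'n form"
  where "fmult \<Xi> \<alpha> \<beta> =
    (\<chi> K. \<Sum>I\<in>Pow K. scaleT (shuffle_sign I (K - I)) (multT \<Xi> (\<alpha> $ I) (\<beta> $ (K - I))))"

definition fstar :: "'n::{finite,linorder} rmatrix \<Rightarrow> 'n form \<Rightarrow> 'n form"
  where "fstar \<Xi> \<alpha> = (\<chi> I. starT \<Xi> (\<alpha> $ I))"

definition fdiff :: "'n::{finite,linorder} form \<Rightarrow> 'n form"
  where "fdiff \<alpha> =
    (\<chi> K. \<Sum>j\<in>K. scaleT (\<i> * shuffle_sign {j} (K - {j})) (derivT j (\<alpha> $ (K - {j}))))"

text \<open>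
  The complex-linear Hodge operator, normalised by \<open>e\<^sub>I \<and> \<star> e\<^sub>I = e\<^sub>1 \<and> \<dots> \<and> e\<^sub>n\<close>.
\<close>

definition hodge :: "'n::{finite,linorder} form \<Rightarrow> 'n form"
  where "hodge \<alpha> = (\<chi> K. scaleT (shuffle_sign (- K) K) (\<alpha> $ (- K)))"

text \<open>
  The integral of \<open>x d\<U>\<^sub>1 \<dots> d\<U>\<^sub>n\<close> is the Dixmier trace of \<open>x |D|\<^sup>-\<^sup>n\<close>, a positive multiple of \<open>tau0 x\<close>.
  The parameter \<open>c\<close> is the proportionality factor.
\<close>

definition form_integral :: "real \<Rightarrow> 'n::finite form \<Rightarrow> complex"
  where "form_integral c \<alpha> = of_real c * tau0 (\<alpha> $ UNIV)"

definition form_inner :: "real \<Rightarrow> 'n::{finite,linorder} rmatrix \<Rightarrow> 'n form \<Rightarrow> 'n form \<Rightarrow> complex"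
  where "form_inner c \<Xi> \<mu> \<nu> =
    (\<Sum>k\<le>CARD('n). form_integral c (fmult \<Xi> (fstar \<Xi> (form_part k \<mu>)) (hodge (form_part k \<nu>))))"

section \<open>The calculus on U(1)\<close>

text \<open>The basis element \<open>z\<^sup>m \<vartheta>\<^sup>k\<close> of the envelope has index \<open>(m, k)\<close>.\<close>

type_synonym gamma_index = "int \<times> nat"
type_synonym gamma = "gamma_index \<Rightarrow>\<^sub>0 complex"

definition gbasis :: "gamma_index \<Rightarrow> gamma"
  where "gbasis b = Poly_Mapping.single b 1"

definition gscale :: "complex \<Rightarrow> gamma \<Rightarrow> gamma"
  where "gscale c g = Poly_Mapping.map (\<lambda>w. c * w) g"

text \<open>\<open>\<vartheta> z = - z \<vartheta>\<close>, hence \<open>\<vartheta>\<^sup>k z\<^sup>m = (-1)\<^sup>k\<^sup>m z\<^sup>m \<vartheta>\<^sup>k\<close>.\<close>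

definition theta_z_sign :: "nat \<Rightarrow> int \<Rightarrow> complex"
  where "theta_z_sign k m = (if odd (int k * m) then - 1 else 1)"

definition gmult :: "gamma \<Rightarrow> gamma \<Rightarrow> gamma"
  where "gmult g h =
    (\<Sum>(m, k)\<in>Poly_Mapping.keys g. \<Sum>(m', k')\<in>Poly_Mapping.keys h.
      Poly_Mapping.single (m + m', k + k')
        (theta_z_sign k m' * Poly_Mapping.lookup g (m, k) * Poly_Mapping.lookup h (m', k')))"

text \<open>\<open>(\<vartheta>\<^sup>k)\<^sup>* = (-1)\<^sup>k\<^sup>(\<^sup>k\<^sup>-\<^sup>1\<^sup>)\<^sup>/\<^sup>2 \<vartheta>\<^sup>k\<close> by the graded rule for \<open>(a b)\<^sup>*\<close>.\<close>

definition gstar :: "gamma \<Rightarrow> gamma"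
  where "gstar g =
    (\<Sum>(m, k)\<in>Poly_Mapping.keys g.
      gscale ((- 1) ^ (k choose 2) * cnj (Poly_Mapping.lookup g (m, k)))
        (gmult (gbasis (0, k)) (gbasis (- m, 0))))"

text \<open>The quantum germs map: \<open>\<pi>(z\<^sup>m) = \<vartheta>\<close> for odd \<open>m\<close> and \<open>0\<close> for even \<open>m\<close>, so that \<open>d z\<^sup>m = z\<^sup>m \<pi>(z\<^sup>m)\<close>.\<close>

definition germ :: "int \<Rightarrow> gamma"
  where "germ m = (if odd m then gbasis (0, 1) else 0)"

text \<open>\<open>d (\<vartheta>\<^sup>k)\<close>, by \<open>d \<vartheta> = - \<vartheta> \<vartheta>\<close> and the graded Leibniz rule.\<close>

primrec diff_theta_power :: "nat \<Rightarrow> gamma"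
  where
    "diff_theta_power 0 = 0"
  | "diff_theta_power (Suc k) =
      gmult (- gbasis (0, 2)) (gbasis (0, k)) - gmult (gbasis (0, 1)) (diff_theta_power k)"

definition gdiff :: "gamma \<Rightarrow> gamma"
  where "gdiff g =
    (\<Sum>(m, k)\<in>Poly_Mapping.keys g. gscale (Poly_Mapping.lookup g (m, k))
      (gmult (gmult (gbasis (m, 0)) (germ m)) (gbasis (0, k)) + gmult (gbasis (m, 0)) (diff_theta_power k)))"

type_synonym gamma2 = "gamma_index \<times> gamma_index \<Rightarrow>\<^sub>0 complex"

definition gtensor :: "complex \<Rightarrow> gamma \<Rightarrow> gamma \<Rightarrow> gamma2"
  where "gtensor c g h =
    (\<Sum>b\<in>Poly_Mapping.keys g. \<Sum>b'\<in>Poly_Mapping.keys h.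
      Poly_Mapping.single (b, b') (c * Poly_Mapping.lookup g b * Poly_Mapping.lookup h b'))"

text \<open>The graded tensor product algebra \<open>\<Gamma>\<^sup>\<and> \<otimes> \<Gamma>\<^sup>\<and>\<close>.\<close>

definition gmult2 :: "gamma2 \<Rightarrow> gamma2 \<Rightarrow> gamma2"
  where "gmult2 x y =
    (\<Sum>(a, b)\<in>Poly_Mapping.keys x. \<Sum>(a', b')\<in>Poly_Mapping.keys y.
      gtensor ((- 1) ^ (snd b * snd a') * Poly_Mapping.lookup x (a, b) * Poly_Mapping.lookup y (a', b'))
        (gmult (gbasis a) (gbasis a')) (gmult (gbasis b) (gbasis b')))"

text \<open>
  The coproduct is multiplicative, with \<open>z \<mapsto> z \<otimes> z\<close> and \<open>\<vartheta> \<mapsto> 1 \<otimes> \<vartheta> + \<vartheta> \<otimes> 1\<close>.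
\<close>

primrec coprod_theta_power :: "nat \<Rightarrow> gamma2"
  where
    "coprod_theta_power 0 = gtensor 1 (gbasis (0, 0)) (gbasis (0, 0))"
  | "coprod_theta_power (Suc k) =
      gmult2 (gtensor 1 (gbasis (0, 0)) (gbasis (0, 1)) + gtensor 1 (gbasis (0, 1)) (gbasis (0, 0)))
        (coprod_theta_power k)"

definition coprod_basis :: "gamma_index \<Rightarrow> gamma2"
  where "coprod_basis b =
    gmult2 (gtensor 1 (gbasis (fst b, 0)) (gbasis (fst b, 0))) (coprod_theta_power (snd b))"

section \<open>The bundle and its differential forms\<close>

text \<open>
  Elements of \<open>\<Omega>(\<T>) \<otimes> \<Gamma>\<^sup>\<and>\<close>, respectively \<open>\<Omega>(\<T>) \<otimes> \<Gamma>\<^sup>\<and> \<otimes> \<Gamma>\<^sup>\<and>\<close>, are represented by their coordinates in \<open>\<Omega>(\<T>)\<close>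
  with respect to the basis of \<open>\<Gamma>\<^sup>\<and>\<close>, respectively \<open>\<Gamma>\<^sup>\<and> \<otimes> \<Gamma>\<^sup>\<and>\<close>.
\<close>

type_synonym 'n pform = "gamma_index \<Rightarrow>\<^sub>0 'n form"
type_synonym 'n pform2 = "gamma_index \<times> gamma_index \<Rightarrow>\<^sub>0 'n form"

definition pscale :: "complex \<Rightarrow> 'n::finite pform \<Rightarrow> 'n pform"
  where "pscale c x = Poly_Mapping.map (fscale c) x"

definition ptensor :: "'n::finite form \<Rightarrow> gamma \<Rightarrow> 'n pform"
  where "ptensor \<alpha> g =
    (\<Sum>b\<in>Poly_Mapping.keys g. Poly_Mapping.single b (fscale (Poly_Mapping.lookup g b) \<alpha>))"

text \<open>The embedding \<open>\<alpha> \<mapsto> \<alpha> \<otimes> 1\<close> of the forms of the base.\<close>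

definition base_form :: "'n::finite form \<Rightarrow> 'n pform"
  where "base_form \<alpha> = ptensor \<alpha> (gbasis (0, 0))"

definition degree_sign :: "nat \<Rightarrow> 'n::finite form \<Rightarrow> 'n form"
  where "degree_sign k \<alpha> = (\<chi> I. scaleT ((- 1) ^ (k * card I)) (\<alpha> $ I))"

text \<open>
  Graded tensor product: \<open>(\<alpha> \<otimes> g) (\<beta> \<otimes> h) = (-1)\<^sup>|\<^sup>g\<^sup>|\<^sup>|\<^sup>\<beta>\<^sup>| \<alpha> \<beta> \<otimes> g h\<close>, \<open>(\<alpha> \<otimes> g)\<^sup>* = \<alpha>\<^sup>* \<otimes> g\<^sup>*\<close> and
  \<open>d (\<alpha> \<otimes> g) = d \<alpha> \<otimes> g + (-1)\<^sup>|\<^sup>\<alpha>\<^sup>| \<alpha> \<otimes> d g\<close>.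
\<close>

definition pmult :: "'n::{finite,linorder} rmatrix \<Rightarrow> 'n pform \<Rightarrow> 'n pform \<Rightarrow> 'n pform"
  where "pmult \<Xi> x y =
    (\<Sum>a\<in>Poly_Mapping.keys x. \<Sum>b\<in>Poly_Mapping.keys y.
      ptensor (fmult \<Xi> (Poly_Mapping.lookup x a) (degree_sign (snd a) (Poly_Mapping.lookup y b)))
        (gmult (gbasis a) (gbasis b)))"

definition pstar :: "'n::{finite,linorder} rmatrix \<Rightarrow> 'n pform \<Rightarrow> 'n pform"
  where "pstar \<Xi> x =
    (\<Sum>b\<in>Poly_Mapping.keys x. ptensor (fstar \<Xi> (Poly_Mapping.lookup x b)) (gstar (gbasis b)))"

definition pdiff :: "'n::{finite,linorder} pform \<Rightarrow> 'n pform"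
  where "pdiff x =
    (\<Sum>b\<in>Poly_Mapping.keys x.
      ptensor (fdiff (Poly_Mapping.lookup x b)) (gbasis b)
      + ptensor (degree_sign 1 (Poly_Mapping.lookup x b)) (gdiff (gbasis b)))"

definition ppart :: "nat \<Rightarrow> 'n::finite pform \<Rightarrow> 'n pform"
  where "ppart k x =
    (\<Sum>b\<in>Poly_Mapping.keys x.
      Poly_Mapping.single b (\<chi> I. if card I + snd b = k then Poly_Mapping.lookup x b $ I else 0))"

definition horizontal :: "'n::finite pform set"
  where "horizontal = {x. \<forall>b\<in>Poly_Mapping.keys x. snd b = 0}"

definition ptensor_gamma :: "'n::finite pform \<Rightarrow> gamma \<Rightarrow> 'n pform2"
  where "ptensor_gamma x g =
    (\<Sum>a\<in>Poly_Mapping.keys x. \<Sum>b\<in>Poly_Mapping.keys g.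
      Poly_Mapping.single (a, b) (fscale (Poly_Mapping.lookup g b) (Poly_Mapping.lookup x a)))"

text \<open>The coaction \<open>id \<otimes> \<Delta>\<close> on differential forms.\<close>

definition pcoaction :: "'n::finite pform \<Rightarrow> 'n pform2"
  where "pcoaction x =
    (\<Sum>b\<in>Poly_Mapping.keys x. \<Sum>p\<in>Poly_Mapping.keys (coprod_basis b).
      Poly_Mapping.single p (fscale (Poly_Mapping.lookup (coprod_basis b) p) (Poly_Mapping.lookup x b)))"

section \<open>Quantum principal connections\<close>

text \<open>The quantum dual Lie algebra is \<open>\<complex> \<vartheta>\<close>; the complex number \<open>c\<close> stands for \<open>c \<vartheta>\<close>.\<close>

type_synonym qu = complex

definition vartheta :: qu
  where "vartheta = 1"

definition qu_to_gamma :: "qu \<Rightarrow> gamma"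
  where "qu_to_gamma \<theta> = Poly_Mapping.single (0, 1) \<theta>"

text \<open>The adjoint coaction \<open>ad(\<theta>) = \<theta> \<otimes> 1\<close>, with values in \<open>\<complex> \<vartheta> \<otimes> G\<close>.\<close>

definition ad :: "qu \<Rightarrow> (gamma_index \<Rightarrow>\<^sub>0 qu)"
  where "ad \<theta> = Poly_Mapping.single (0, 0) \<theta>"

definition qu_tensor_id :: "(qu \<Rightarrow> 'n::finite pform) \<Rightarrow> (gamma_index \<Rightarrow>\<^sub>0 qu) \<Rightarrow> 'n pform2"
  where "qu_tensor_id T x =
    (\<Sum>b\<in>Poly_Mapping.keys x. ptensor_gamma (T (Poly_Mapping.lookup x b)) (gbasis b))"

abbreviation qu_linear :: "(qu \<Rightarrow> 'n::finite pform) \<Rightarrow> bool"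
  where "qu_linear T \<equiv> Vector_Spaces.linear (*) pscale T"

definition connection :: "'n::{finite,linorder} rmatrix \<Rightarrow> (qu \<Rightarrow> 'n pform) \<Rightarrow> bool"
  where "connection \<Xi> \<omega> \<longleftrightarrow>
    qu_linear \<omega> \<and>
    (\<forall>\<theta>. ppart 1 (\<omega> \<theta>) = \<omega> \<theta>) \<and>
    (\<forall>\<theta>. pcoaction (\<omega> \<theta>) =
      qu_tensor_id \<omega> (ad \<theta>) + ptensor_gamma (base_form (scalar_form oneT)) (qu_to_gamma \<theta>)) \<and>
    (\<forall>\<theta>. \<omega> (cnj \<theta>) = pstar \<Xi> (\<omega> \<theta>))"

definition canonical_connection :: "qu \<Rightarrow> 'n::finite pform"
  where "canonical_connection \<theta> = ptensor (scalar_form oneT) (qu_to_gamma \<theta>)"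

text \<open>The product composed with \<open>T\<^sub>1 \<otimes> T\<^sub>2\<close> and the embedded differential \<open>\<Theta>(\<vartheta>) = - \<vartheta> \<otimes> \<vartheta>\<close>.\<close>

definition bracket ::
    "'n::{finite,linorder} rmatrix \<Rightarrow> (qu \<Rightarrow> 'n pform) \<Rightarrow> (qu \<Rightarrow> 'n pform) \<Rightarrow> qu \<Rightarrow> 'n pform"
  where "bracket \<Xi> T\<^sub>1 T\<^sub>2 \<theta> = pscale \<theta> (- pmult \<Xi> (T\<^sub>1 vartheta) (T\<^sub>2 vartheta))"

definition curvature ::
    "'n::{finite,linorder} rmatrix \<Rightarrow> (qu \<Rightarrow> 'n pform) \<Rightarrow> qu \<Rightarrow> 'n pform"
  where "curvature \<Xi> \<omega> \<theta> = pdiff (\<omega> \<theta>) - bracket \<Xi> \<omega> \<omega> \<theta>"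

section \<open>The Yang--Mills equation\<close>

text \<open>
  The intertwiners between \<open>ad\<close> and the coaction on horizontal forms. As \<open>ad\<close> is trivial, these
  are the linear maps with values in \<open>\<Omega>(\<T>) \<otimes> 1\<close>.
\<close>

definition Mor_hor :: "(qu \<Rightarrow> 'n::finite pform) set"
  where "Mor_hor =
    {\<tau>. qu_linear \<tau> \<and> (\<forall>\<theta>. \<tau> \<theta> \<in> horizontal) \<and> (\<forall>\<theta>. pcoaction (\<tau> \<theta>) = qu_tensor_id \<tau> (ad \<theta>))}"

definition Mor_bundle :: "(qu \<Rightarrow> 'n::finite pform) set"
  where "Mor_bundle = {\<tau>\<in>Mor_hor. \<forall>\<theta>. ppart 0 (\<tau> \<theta>) = \<tau> \<theta>}"

text \<open>
  \<open>E \<otimes> \<Omega>(\<T>)\<close>, balanced over the quantum torus, as the free abelian group on the pairs modulo the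
  biadditive and balancing relations. Its elements are cosets, and its zero element is \<open>\<one>\<close>.
\<close>

abbreviation pairs_group :: "((qu \<Rightarrow> 'n::finite pform) \<times> 'n form \<Rightarrow>\<^sub>0 int) monoid"
  where "pairs_group \<equiv> free_Abelian_group (Mor_bundle \<times> UNIV)"

definition tensor_relators ::
    "'n::{finite,linorder} rmatrix \<Rightarrow> ((qu \<Rightarrow> 'n pform) \<times> 'n form \<Rightarrow>\<^sub>0 int) set"
  where "tensor_relators \<Xi> =
    {frag_of (\<lambda>\<theta>. S \<theta> + T \<theta>, \<nu>) - frag_of (S, \<nu>) - frag_of (T, \<nu>) | S T \<nu>. S \<in> Mor_bundle \<and> T \<in> Mor_bundle}
    \<union> {frag_of (T, \<mu> + \<nu>) - frag_of (T, \<mu>) - frag_of (T, \<nu>) | T \<mu> \<nu>. T \<in> Mor_bundle}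
    \<union> {frag_of (\<lambda>\<theta>. pmult \<Xi> (T \<theta>) (base_form (scalar_form a)), \<nu>) - frag_of (T, fmult \<Xi> (scalar_form a) \<nu>)
        | T a \<nu>. T \<in> Mor_bundle}"

type_synonym 'n tensor = "((qu \<Rightarrow> 'n pform) \<times> 'n form \<Rightarrow>\<^sub>0 int) set"

definition tensor_group ::
    "'n::{finite,linorder} rmatrix \<Rightarrow> 'n tensor monoid"
  where "tensor_group \<Xi> = pairs_group Mod generate pairs_group (tensor_relators \<Xi>)"

text \<open>
  Maps on the tensor product are given on formal sums of pairs and evaluated at an arbitrary
  representative of the coset; they do not depend on its choice.
\<close>

definition representative :: "('a \<Rightarrow>\<^sub>0 int) set \<Rightarrow> 'a \<Rightarrow>\<^sub>0 int"
  where "representative X = (SOME x. x \<in> X)"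

definition Upsilon_inv ::
    "'n::{finite,linorder} rmatrix \<Rightarrow> 'n tensor \<Rightarrow> qu \<Rightarrow> 'n pform"
  where "Upsilon_inv \<Xi> X \<theta> =
    (let x = representative X in
      \<Sum>(T, \<nu>)\<in>Poly_Mapping.keys x.
        pscale (of_int (Poly_Mapping.lookup x (T, \<nu>))) (pmult \<Xi> (T \<theta>) (base_form \<nu>)))"

definition Upsilon ::
    "'n::{finite,linorder} rmatrix \<Rightarrow> (qu \<Rightarrow> 'n pform) \<Rightarrow> 'n tensor"
  where "Upsilon \<Xi> = inv_into (carrier (tensor_group \<Xi>)) (Upsilon_inv \<Xi>)"

text \<open>The hermitian structure \<open>\<langle>T\<^sub>1, T\<^sub>2\<rangle>\<^sub>R\<close>, as the element \<open>a\<close> of the quantum torus with \<open>T\<^sub>1(\<vartheta>)\<^sup>* T\<^sub>2(\<vartheta>) = a \<otimes> 1\<close>.\<close>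

definition hermitian ::
    "'n::{finite,linorder} rmatrix \<Rightarrow> (qu \<Rightarrow> 'n pform) \<Rightarrow> (qu \<Rightarrow> 'n pform) \<Rightarrow> 'n qtorus"
  where "hermitian \<Xi> T\<^sub>1 T\<^sub>2 =
    (THE a. base_form (scalar_form a) = pmult \<Xi> (pstar \<Xi> (T\<^sub>1 vartheta)) (T\<^sub>2 vartheta))"

definition tensor_inner ::
    "real \<Rightarrow> 'n::{finite,linorder} rmatrix \<Rightarrow> 'n tensor
      \<Rightarrow> 'n tensor \<Rightarrow> complex"
  where "tensor_inner c \<Xi> X Y =
    (let x = representative X; y = representative Y in
      \<Sum>(S, \<mu>)\<in>Poly_Mapping.keys x. \<Sum>(T, \<nu>)\<in>Poly_Mapping.keys y.
        of_int (Poly_Mapping.lookup x (S, \<mu>) * Poly_Mapping.lookup y (T, \<nu>))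
          * form_inner c \<Xi> \<mu> (fmult \<Xi> (scalar_form (hermitian \<Xi> S T)) \<nu>))"

text \<open>
  The defining formula of \<open>DS\<close> is for values in degree \<open>k\<close>; it is extended additively over the
  homogeneous components.
\<close>

definition DS ::
    "'n::{finite,linorder} rmatrix \<Rightarrow> (qu \<Rightarrow> 'n pform) \<Rightarrow> (qu \<Rightarrow> 'n pform) \<Rightarrow> qu \<Rightarrow> 'n pform"
  where "DS \<Xi> \<omega> \<tau> \<theta> =
    (\<Sum>k\<le>CARD('n). let \<tau>\<^sub>k = (\<lambda>\<eta>. ppart k (\<tau> \<eta>)) in
      pdiff (\<tau>\<^sub>k \<theta>) - bracket \<Xi> \<omega> \<tau>\<^sub>k \<theta> + pscale ((- 1) ^ k) (bracket \<Xi> \<tau>\<^sub>k \<omega> \<theta>))"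

definition conjugate_map ::
    "'n::{finite,linorder} rmatrix \<Rightarrow> (qu \<Rightarrow> 'n pform) \<Rightarrow> qu \<Rightarrow> 'n pform"
  where "conjugate_map \<Xi> \<tau> \<theta> = pstar \<Xi> (\<tau> (cnj \<theta>))"

definition DS_hat ::
    "'n::{finite,linorder} rmatrix \<Rightarrow> (qu \<Rightarrow> 'n pform) \<Rightarrow> (qu \<Rightarrow> 'n pform) \<Rightarrow> qu \<Rightarrow> 'n pform"
  where "DS_hat \<Xi> \<omega> \<tau> = conjugate_map \<Xi> (DS \<Xi> \<omega> (conjugate_map \<Xi> \<tau>))"

definition exterior_DS_hat ::
    "'n::{finite,linorder} rmatrix \<Rightarrow> (qu \<Rightarrow> 'n pform)
      \<Rightarrow> 'n tensor \<Rightarrow> 'n tensor"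
  where "exterior_DS_hat \<Xi> \<omega> X = Upsilon \<Xi> (DS_hat \<Xi> \<omega> (Upsilon_inv \<Xi> X))"

text \<open>
  The value of the formal adjoint at \<open>X\<close>; there is at most one such \<open>Z\<close>, since \<open>tensor_inner\<close> is
  nondegenerate for \<open>c > 0\<close>.
\<close>

definition formal_adjoint ::
    "real \<Rightarrow> 'n::{finite,linorder} rmatrix
      \<Rightarrow> ('n tensor \<Rightarrow> 'n tensor)
      \<Rightarrow> 'n tensor \<Rightarrow> 'n tensor"
  where "formal_adjoint c \<Xi> D X =
    (THE Z. Z \<in> carrier (tensor_group \<Xi>) \<and>
      (\<forall>Y\<in>carrier (tensor_group \<Xi>). tensor_inner c \<Xi> Z Y = tensor_inner c \<Xi> X (D Y)))"

definition yang_mills ::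
    "real \<Rightarrow> 'n::{finite,linorder} rmatrix \<Rightarrow> (qu \<Rightarrow> 'n pform) \<Rightarrow> bool"
  where "yang_mills c \<Xi> \<omega> \<longleftrightarrow>
    connection \<Xi> \<omega> \<and>
    formal_adjoint c \<Xi> (exterior_DS_hat \<Xi> \<omega>) (Upsilon \<Xi> (curvature \<Xi> \<omega>)) = \<one>\<^bsub>tensor_group \<Xi>\<^esub>"

end

theory Submission
  imports Defs
begin

text \<open>
  A horizontal intertwiner is \<open>\<theta> \<mapsto> \<theta> \<alpha> \<otimes> 1\<close> for a unique form \<open>\<alpha>\<close> on the quantum torus (\<open>Mor_hor_iff\<close>), and \<open>E\<close> is
  a free module of rank one. Every class in \<open>E \<otimes> \<Omega>\<close> is therefore \<open>1 \<otimes> \<nu>\<close> for a unique form \<open>\<nu>\<close>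
  (\<open>carrier_tensor_group\<close>, \<open>pure_tensor_inject\<close>). Under this identification the pairing of tensors becomes the inner product
  of forms, and the Yang--Mills condition becomes a statement about forms on the torus alone.

  The calculus on the group enters only through \<open>\<vartheta>\<close>, which has degree \<open>1\<close>, graded commutes with the forms of
  the base and satisfies \<open>d \<vartheta> = - \<vartheta> \<vartheta>\<close>. So all its contributions cancel: the curvature is \<open>F = d\<mu> + \<mu> \<mu>\<close>
  (\<open>curvature_connection_of\<close>), and the exterior derivative obtained from \<open>DS_hat\<close> is \<open>- \<nabla>\<close>, where
  \<open>\<nabla>\<nu> = d\<nu> + \<mu> \<nu> - (-1)\<^sup>|\<^sup>\<nu>\<^sup>| \<nu> \<mu>\<close> (\<open>DS_hat_base_map\<close>). Although the calculus is one-dimensional and the group is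
  abelian, the graded commutator with \<open>\<mu>\<close> remains.

  It is left to compute the adjoint of \<open>- \<nabla>\<close> at \<open>F\<close>. As \<open>F\<close> is antihermitian and the integral is a trace, the
  pairing of \<open>F\<close> with \<open>- \<nabla>\<nu>\<close> is the integral of \<open>\<nabla>\<nu> \<star>F\<close>. The integral is a closed graded trace
  (\<open>top_trace_fdiff\<close>, \<open>top_trace_graded_commute\<close>), so integration by parts turns this into the integral of
  \<open>\<nu> W\<close> with \<open>W = d \<star>F + \<mu> \<star>F + (-1)\<^sup>n\<^sup>-\<^sup>1 \<star>F \<mu>\<close> (\<open>top_trace_covariant_diff\<close>). Here \<open>n \<ge> 2\<close> ensures that
  \<open>W\<close> has degree \<open>n - 1\<close>. The integral is nondegenerate and the Hodge operator is bijective, hence the adjoint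
  exists at \<open>F\<close>, is unique, and vanishes if and only if \<open>W = 0\<close>.
\<close>

section \<open>The algebra of the quantum torus\<close>

global_interpretation scaleT: vector_space "scaleT :: complex \<Rightarrow> 'n::finite qtorus \<Rightarrow> 'n qtorus"
  by unfold_locales (transfer; simp add: algebra_simps fun_eq_iff)+

lemma qtorus_eqI: "(\<And>k. coeffs a k = coeffs b k) \<Longrightarrow> a = b"
  by (simp add: coeffs_inject[symmetric] fun_eq_iff)

text \<open>
  The exponent of the phase is a bilinear form in \<open>k\<close> and \<open>l\<close>, so the phase is a bicharacter of the lattice.
  Associativity, the rule for the adjoint of a product and the trace property all come down to this.
\<close>

lemma reorder_add_left: "reorder \<Xi> (k + k') l = reorder \<Xi> k l * reorder \<Xi> k' l"
  by (simp add: reorder_def exp_add[symmetric] algebra_simps sum.distrib)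

lemma reorder_add_right: "reorder \<Xi> k (l + l') = reorder \<Xi> k l * reorder \<Xi> k l'"
  by (simp add: reorder_def exp_add[symmetric] algebra_simps sum.distrib)

lemma reorder_zero_left: "reorder \<Xi> 0 l = 1"
  by (simp add: reorder_def)

lemma reorder_zero_right: "reorder \<Xi> k 0 = 1"
  by (simp add: reorder_def)

lemma reorder_minus_right: "reorder \<Xi> k (- l) = reorder \<Xi> (- k) l"
  by (simp add: reorder_def)

lemma cnj_reorder: "cnj (reorder \<Xi> k l) = reorder \<Xi> (- k) l"
  by (simp add: reorder_def exp_cnj sum_negf)

lemma reorder_nonzero: "reorder \<Xi> k l \<noteq> 0"
  by (simp add: reorder_def)

lemma rapidly_decaying_coeffs: "rapidly_decaying (coeffs a)"
  using coeffs by auto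

text \<open>
  Decay of order \<open>2 n\<close> is enough for summability over an \<open>n\<close>-dimensional lattice. All series below
  therefore converge absolutely and may be split, shifted and interchanged.
\<close>

lemma coeffs_abs_summable: "(\<lambda>k. cmod (coeffs (a :: 'n::finite qtorus) k)) summable_on UNIV"
proof -
  obtain C where C: "\<And>k. (1 + l1norm k) ^ (2 * CARD('n)) * cmod (coeffs a k) \<le> C"
    using rapidly_decaying_coeffs[of a] unfolding rapidly_decaying_def by metis
  show ?thesis
  proof (rule summable_on_comparison_test)
    show "(\<lambda>k::'n lattice. C * (1 / (1 + l1norm k) ^ (2 * CARD('n)))) summable_on UNIV"
      by (intro summable_on_cmult_right summable_l1norm)
    show "cmod (coeffs a k) \<le> C * (1 / (1 + l1norm k) ^ (2 * CARD('n)))" for k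
    proof -
      have "0 < (1 + l1norm k) ^ (2 * CARD('n))"
        using l1norm_nonneg[of k] by simp
      then show ?thesis
        using C[of k] by (simp add: field_simps)
    qed
  qed simp
qed

lemma coeffs_bounded:
  obtains C where "\<And>k. cmod (coeffs a k) \<le> C"
  using that rapidly_decaying_coeffs[of a, unfolded rapidly_decaying_def, rule_format, of 0] by auto

lemma convolution_summable:
  assumes "\<And>k. cmod (c k) = 1"
  shows "(\<lambda>k. c k * coeffs a k * coeffs b (m - k)) summable_on UNIV"
proof -
  obtain C where C: "\<And>k. cmod (coeffs b k) \<le> C"
    using coeffs_bounded[of b] by blast
  have "(\<lambda>k. norm (c k * coeffs a k * coeffs b (m - k))) summable_on UNIV"
  proof (rule summable_on_comparison_test)
    show "(\<lambda>k. cmod (coeffs a k) * C) summable_on UNIV"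
      by (intro summable_on_cmult_left coeffs_abs_summable)
  qed (auto simp: norm_mult assms intro!: mult_left_mono C)
  then show ?thesis
    by (rule abs_summable_summable)
qed

lemma multT_add_left: "multT \<Xi> (a + b) c = multT \<Xi> a c + multT \<Xi> b c"
  by (rule qtorus_eqI)
     (simp add: multT.rep_eq plus_qtorus.rep_eq distrib_left distrib_right
       infsum_add[OF convolution_summable convolution_summable] norm_reorder)

lemma multT_add_right: "multT \<Xi> a (b + c) = multT \<Xi> a b + multT \<Xi> a c"
  by (rule qtorus_eqI)
     (simp add: multT.rep_eq plus_qtorus.rep_eq distrib_left
       infsum_add[OF convolution_summable convolution_summable] norm_reorder)

lemma multT_scale_left: "multT \<Xi> (scaleT z a) b = scaleT z (multT \<Xi> a b)"
  by (rule qtorus_eqI) (simp add: multT.rep_eq scaleT.rep_eq mult_ac flip: infsum_cmult_right')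

lemma multT_scale_right: "multT \<Xi> a (scaleT z b) = scaleT z (multT \<Xi> a b)"
  by (rule qtorus_eqI) (simp add: multT.rep_eq scaleT.rep_eq mult_ac flip: infsum_cmult_right')

lemma multT_zero_left [simp]: "multT \<Xi> 0 b = 0"
  using multT_scale_left[of \<Xi> 0 0 b] by simp

lemma multT_zero_right [simp]: "multT \<Xi> a 0 = 0"
  using multT_scale_right[of \<Xi> a 0 0] by simp

lemma multT_minus_left: "multT \<Xi> (- a) b = - multT \<Xi> a b"
  using multT_scale_left[of \<Xi> "-1" a b] by simp

lemma multT_sum_left: "multT \<Xi> (sum f A) b = (\<Sum>x\<in>A. multT \<Xi> (f x) b)"
  by (induction A rule: infinite_finite_induct) (simp_all add: multT_add_left)

lemma multT_sum_right: "multT \<Xi> a (sum f A) = (\<Sum>x\<in>A. multT \<Xi> a (f x))"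
  by (induction A rule: infinite_finite_induct) (simp_all add: multT_add_right)

lemma infsum_UNIV_single:
  assumes "\<And>k. k \<noteq> k0 \<Longrightarrow> f k = (0::complex)"
  shows "infsum f UNIV = f k0"
proof -
  have "infsum f UNIV = infsum f {k0}"
    by (rule infsum_cong_neutral) (use assms in auto)
  then show ?thesis by simp
qed

lemma multT_one_left [simp]: "multT \<Xi> oneT a = a"
  by (rule qtorus_eqI)
     (simp add: multT.rep_eq oneT.rep_eq infsum_UNIV_single[where ?k0.0 = 0] reorder_zero_left)

lemma multT_one_right [simp]: "multT \<Xi> a oneT = a"
proof (rule qtorus_eqI)
  show "coeffs (multT \<Xi> a oneT) k = coeffs a k" for k
    by (simp add: multT.rep_eq oneT.rep_eq infsum_UNIV_single[where ?k0.0 = k] reorder_zero_right)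
qed

text \<open>
  By absolute convergence the two summations may be interchanged. After the shift \<open>l = k + j\<close> the two
  sides agree term by term, because a bicharacter satisfies the 2-cocycle identity.
\<close>

lemma multT_assoc: "multT \<Xi> (multT \<Xi> a b) c = multT \<Xi> a (multT \<Xi> b c)"
proof (rule qtorus_eqI)
  fix m
  let ?r = "reorder \<Xi>"
  define f where "f = (\<lambda>l k. ?r l (m - l) * ?r k (l - k) * coeffs a k * coeffs b (l - k) * coeffs c (m - l))"
  obtain C where C: "\<And>k. cmod (coeffs c k) \<le> C"
    using coeffs_bounded[of c] by blast
  have summable: "(\<lambda>(l, k). f l k) summable_on UNIV \<times> UNIV"
  proof (rule abs_summable_summable, rule summable_on_comparison_test)
    let ?B = "\<Sum>\<^sub>\<infinity>j. cmod (coeffs b j)"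
    have "(\<lambda>(k, l). cmod (coeffs b (l - k)) * cmod (coeffs a k)) summable_on UNIV \<times> UNIV"
    proof (rule summable_on_SigmaI)
      fix k
      have "((\<lambda>j. cmod (coeffs b j)) has_sum ?B) UNIV"
        by (intro has_sum_infsum coeffs_abs_summable)
      then have "((\<lambda>l. cmod (coeffs b (l - k))) has_sum ?B) UNIV"
        by (subst has_sum_reindex_bij_witness[of _ "\<lambda>j. j + k" "\<lambda>l. l - k"]) auto
      then show "((\<lambda>l. case (k, l) of (k, l) \<Rightarrow> cmod (coeffs b (l - k)) * cmod (coeffs a k))
          has_sum ?B * cmod (coeffs a k)) UNIV"
        by (simp add: has_sum_cmult_left)
    qed (auto intro!: summable_on_cmult_right coeffs_abs_summable)
    then have "(\<lambda>(l, k). cmod (coeffs b (l - k)) * cmod (coeffs a k)) summable_on UNIV \<times> UNIV"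
      by (subst summable_on_swap) (simp add: case_prod_unfold prod.swap_def)
    then show "(\<lambda>p. (case p of (l, k) \<Rightarrow> cmod (coeffs b (l - k)) * cmod (coeffs a k)) * C) summable_on UNIV \<times> UNIV"
      by (rule summable_on_cmult_left)
    show "norm (case p of (l, k) \<Rightarrow> f l k)
        \<le> (case p of (l, k) \<Rightarrow> cmod (coeffs b (l - k)) * cmod (coeffs a k)) * C" for p
      by (auto simp: f_def norm_mult norm_reorder mult.commute[of "cmod (coeffs a _)"]
          split: prod.split intro!: mult_left_mono C)
  qed simp
  have "coeffs (multT \<Xi> (multT \<Xi> a b) c) m = (\<Sum>\<^sub>\<infinity>l. \<Sum>\<^sub>\<infinity>k. f l k)"
    by (simp add: multT.rep_eq f_def mult.assoc flip: infsum_cmult_right' infsum_cmult_left')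
  also have "\<dots> = (\<Sum>\<^sub>\<infinity>k. \<Sum>\<^sub>\<infinity>l. f l k)"
    by (rule infsum_swap_banach[OF summable])
  also have "\<dots> = (\<Sum>\<^sub>\<infinity>k. \<Sum>\<^sub>\<infinity>j. f (k + j) k)"
  proof (rule infsum_cong)
    fix k
    show "(\<Sum>\<^sub>\<infinity>l. f l k) = (\<Sum>\<^sub>\<infinity>j. f (k + j) k)"
      by (rule infsum_reindex_bij_witness[of _ "\<lambda>j. k + j" "\<lambda>l. l - k"]) auto
  qed
  also have "\<dots> = coeffs (multT \<Xi> a (multT \<Xi> b c)) m"
  proof -
    have "f (k + j) k = ?r k (m - k) * coeffs a k * (?r j (m - k - j) * coeffs b j * coeffs c (m - k - j))" for k j
    proof -
      have "?r (k + j) (m - (k + j)) * ?r k j = ?r k (m - k) * ?r j (m - k - j)"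
        using reorder_add_right[of \<Xi> k "m - k - j" j]
        by (simp add: reorder_add_left diff_diff_eq mult.commute)
      then have cocycle: "?r k j * ?r (k + j) (m - (k + j)) = ?r k (m - k) * ?r j (m - (k + j))"
        by (simp add: diff_diff_eq mult.commute)
      have "f (k + j) k = (?r k j * ?r (k + j) (m - (k + j))) * (coeffs a k * coeffs b j * coeffs c (m - (k + j)))"
        by (simp add: f_def mult_ac)
      then show ?thesis
        unfolding cocycle by (simp add: diff_diff_eq mult_ac)
    qed
    then show ?thesis
      by (simp add: multT.rep_eq flip: infsum_cmult_right')
  qed
  finally show "coeffs (multT \<Xi> (multT \<Xi> a b) c) m = coeffs (multT \<Xi> a (multT \<Xi> b c)) m" .
qed

lemma starT_add: "starT \<Xi> (a + b) = starT \<Xi> a + starT \<Xi> b"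
  by (rule qtorus_eqI) (simp add: starT.rep_eq plus_qtorus.rep_eq algebra_simps)

lemma starT_scale: "starT \<Xi> (scaleT z a) = scaleT (cnj z) (starT \<Xi> a)"
  by (rule qtorus_eqI) (simp add: starT.rep_eq scaleT.rep_eq algebra_simps)

lemma starT_zero [simp]: "starT \<Xi> 0 = 0"
  using starT_scale[of \<Xi> 0 0] by simp

lemma starT_sum: "starT \<Xi> (sum f A) = (\<Sum>x\<in>A. starT \<Xi> (f x))"
  by (induction A rule: infinite_finite_induct) (simp_all add: starT_add)

lemma starT_star [simp]: "starT \<Xi> (starT \<Xi> a) = a"
proof (rule qtorus_eqI)
  fix k
  have "reorder \<Xi> (- k) (- k) * reorder \<Xi> (- k) k = 1"
    using reorder_add_right[of \<Xi> "-k" "-k" k] by (simp add: reorder_zero_right)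
  then show "coeffs (starT \<Xi> (starT \<Xi> a)) k = coeffs a k"
    by (simp add: starT.rep_eq cnj_reorder flip: mult.assoc)
qed

text \<open>
  The substitution \<open>l = m + k\<close> matches the two series. The phases agree since both exponents are equal to
  \<open>B(m, m) + B(k, m) + B(k, k)\<close>, where \<open>B\<close> is the bilinear form in the exponent of the phase.
\<close>

lemma starT_mult: "starT \<Xi> (multT \<Xi> a b) = multT \<Xi> (starT \<Xi> b) (starT \<Xi> a)"
proof (rule qtorus_eqI)
  fix m
  let ?r = "reorder \<Xi>"
  have "coeffs (starT \<Xi> (multT \<Xi> a b)) m
      = (\<Sum>\<^sub>\<infinity>k. ?r m m * ?r k (m + k) * cnj (coeffs a k) * cnj (coeffs b (- m - k)))"
  proof -
    have "cnj (?r k (- m - k)) = ?r k (m + k)" for k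
      using reorder_minus_right[of \<Xi> k "m + k"] reorder_minus_right[of \<Xi> "-k" "m + k"] by (simp add: cnj_reorder)
    then show ?thesis
      by (simp add: starT.rep_eq multT.rep_eq mult.assoc reorder_minus_right
          flip: infsum_cmult_right' infsum_cnj)
  qed
  also have "\<dots> = (\<Sum>\<^sub>\<infinity>l. ?r l (m - l) * (?r l l * cnj (coeffs b (- l)))
      * (?r (m - l) (m - l) * cnj (coeffs a (- (m - l)))))"
  proof (rule infsum_reindex_bij_witness[of _ "\<lambda>l. l - m" "\<lambda>k. m + k"])
    fix k
    have "?r (m + k) (m - (m + k)) * ?r (m + k) (m + k) = ?r (m + k) m"
      using reorder_add_right[of \<Xi> "m + k" "- k" "m + k"] by simp
    moreover have "?r (m + k) m * ?r k k = ?r m m * ?r k (m + k)"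
      by (simp add: reorder_add_left reorder_add_right)
    ultimately have *: "?r (m + k) (m - (m + k)) * ?r (m + k) (m + k) * ?r k k = ?r m m * ?r k (m + k)"
      by simp
    have kk: "?r (m - (m + k)) (m - (m + k)) = ?r k k"
      by (simp add: reorder_minus_right)
    have "?r (m + k) (m - (m + k)) * (?r (m + k) (m + k) * cnj (coeffs b (- (m + k))))
        * (?r (m - (m + k)) (m - (m + k)) * cnj (coeffs a (- (m - (m + k)))))
        = (?r (m + k) (m - (m + k)) * ?r (m + k) (m + k) * ?r k k)
          * cnj (coeffs a k) * cnj (coeffs b (- m - k))"
      unfolding kk by simp
    then show "?r (m + k) (m - (m + k)) * (?r (m + k) (m + k) * cnj (coeffs b (- (m + k))))
        * (?r (m - (m + k)) (m - (m + k)) * cnj (coeffs a (- (m - (m + k)))))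
        = ?r m m * ?r k (m + k) * cnj (coeffs a k) * cnj (coeffs b (- m - k))"
      unfolding * .
  qed auto
  also have "\<dots> = coeffs (multT \<Xi> (starT \<Xi> b) (starT \<Xi> a)) m"
    by (simp add: starT.rep_eq multT.rep_eq reorder_minus_right)
  finally show "coeffs (starT \<Xi> (multT \<Xi> a b)) m = coeffs (multT \<Xi> (starT \<Xi> b) (starT \<Xi> a)) m" .
qed

lemma derivT_add: "derivT j (a + b) = derivT j a + derivT j b"
  by (rule qtorus_eqI) (simp add: derivT.rep_eq plus_qtorus.rep_eq algebra_simps)

lemma derivT_scale: "derivT j (scaleT z a) = scaleT z (derivT j a)"
  by (rule qtorus_eqI) (simp add: derivT.rep_eq scaleT.rep_eq)

lemma derivT_zero [simp]: "derivT j 0 = 0"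
  using derivT_scale[of j 0 0] by simp

lemma derivT_sum: "derivT j (sum f A) = (\<Sum>x\<in>A. derivT j (f x))"
  by (induction A rule: infinite_finite_induct) (simp_all add: derivT_add)

lemma derivT_one [simp]: "derivT j oneT = 0"
  by (rule qtorus_eqI) (simp add: derivT.rep_eq oneT.rep_eq zero_qtorus.rep_eq)

lemma derivT_mult: "derivT j (multT \<Xi> a b) = multT \<Xi> (derivT j a) b + multT \<Xi> a (derivT j b)"
proof (rule qtorus_eqI)
  fix m
  let ?w = "\<lambda>k. 2 * of_real pi * \<i> * of_int (k $ j) :: complex"
  let ?f = "\<lambda>x y k. reorder \<Xi> k (m - k) * coeffs x k * coeffs y (m - k)"
  have split: "?w m * x = ?w k * x + ?w (m - k) * x" for k x
    by (simp add: algebra_simps)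
  have "coeffs (derivT j (multT \<Xi> a b)) m = (\<Sum>\<^sub>\<infinity>k. ?w m * ?f a b k)"
    by (simp add: derivT.rep_eq multT.rep_eq infsum_cmult_right')
  also have "\<dots> = (\<Sum>\<^sub>\<infinity>k. ?f (derivT j a) b k + ?f a (derivT j b) k)"
  proof (rule infsum_cong)
    fix k
    show "?w m * ?f a b k = ?f (derivT j a) b k + ?f a (derivT j b) k"
      unfolding split[where k = k] by (simp only: derivT.rep_eq mult_ac)
  qed
  also have "\<dots> = infsum (?f (derivT j a) b) UNIV + infsum (?f a (derivT j b)) UNIV"
    by (intro infsum_add convolution_summable norm_reorder)
  finally show "coeffs (derivT j (multT \<Xi> a b)) m = coeffs (multT \<Xi> (derivT j a) b + multT \<Xi> a (derivT j b)) m"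
    by (simp add: multT.rep_eq plus_qtorus.rep_eq)
qed

lemma derivT_star: "derivT j (starT \<Xi> a) = starT \<Xi> (derivT j a)"
  by (rule qtorus_eqI) (simp add: derivT.rep_eq starT.rep_eq)

lemma tau0_add: "tau0 (a + b) = tau0 a + tau0 b"
  by (simp add: tau0.rep_eq plus_qtorus.rep_eq)

lemma tau0_scale: "tau0 (scaleT z a) = z * tau0 a"
  by (simp add: tau0.rep_eq scaleT.rep_eq)

lemma tau0_zero [simp]: "tau0 0 = 0"
  by (simp add: tau0.rep_eq zero_qtorus.rep_eq)

lemma tau0_minus: "tau0 (- a) = - tau0 a"
  by (simp add: tau0.rep_eq uminus_qtorus.rep_eq)

lemma tau0_sum: "tau0 (sum f A) = (\<Sum>x\<in>A. tau0 (f x))"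
  by (induction A rule: infinite_finite_induct) (simp_all add: tau0_add)

lemma tau0_deriv: "tau0 (derivT j a) = 0"
  by (simp add: tau0.rep_eq derivT.rep_eq)

text \<open>
  Both sides are series over pairs of opposite lattice points, and the phase of \<open>(k, - k)\<close> is the one of
  \<open>(- k, k)\<close>.
\<close>

lemma tau0_mult_commute: "tau0 (multT \<Xi> a b) = tau0 (multT \<Xi> b a)"
  unfolding tau0.rep_eq multT.rep_eq
  by (rule infsum_reindex_bij_witness[of _ uminus uminus]) (auto simp: reorder_minus_right)

text \<open>
  Pairing with the monomial of exponent \<open>- m\<close> isolates the coefficient at \<open>m\<close>, up to a phase.
\<close>

lemma tau0_nondegenerate:
  fixes a :: "'a::{finite,linorder} qtorus"
  assumes "\<And>b. tau0 (multT \<Xi> a b) = 0"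
  shows "a = 0"
proof (rule qtorus_eqI)
  fix m :: "'a lattice"
  let ?e = "\<lambda>k. if k = - m then 1 else 0 :: complex"
  have "rapidly_decaying ?e"
    unfolding rapidly_decaying_def
  proof
    show "\<exists>C. \<forall>k. (1 + l1norm k) ^ p * cmod (?e k) \<le> C" for p
      by (rule exI[of _ "(1 + l1norm (- m)) ^ p"]) (simp add: l1norm_nonneg)
  qed
  then have e: "coeffs (Abs_qtorus ?e) = ?e"
    by (simp add: Abs_qtorus_inverse)
  have "0 = tau0 (multT \<Xi> a (Abs_qtorus ?e))"
    using assms by simp
  also have "\<dots> = reorder \<Xi> m (- m) * coeffs a m"
    unfolding tau0.rep_eq multT.rep_eq e
    by (subst infsum_UNIV_single[where ?k0.0 = m]) auto
  finally show "coeffs a m = coeffs 0 m"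
    by (simp add: reorder_nonzero zero_qtorus.rep_eq)
qed

section \<open>The graded algebra of forms\<close>

global_interpretation fscale: vector_space "fscale :: complex \<Rightarrow> 'n::finite form \<Rightarrow> 'n form"
  by unfold_locales
     (simp_all add: fscale_def vec_eq_iff scaleT.scale_right_distrib scaleT.scale_left_distrib)

lemma fscale_component [simp]: "fscale z \<alpha> $ I = scaleT z (\<alpha> $ I)"
  by (simp add: fscale_def)

lemma fmult_component:
  "fmult \<Xi> \<alpha> \<beta> $ K = (\<Sum>I\<in>Pow K. scaleT (shuffle_sign I (K - I)) (multT \<Xi> (\<alpha> $ I) (\<beta> $ (K - I))))"
  by (simp add: fmult_def)

lemma fmult_add_left: "fmult \<Xi> (\<alpha> + \<alpha>') \<beta> = fmult \<Xi> \<alpha> \<beta> + fmult \<Xi> \<alpha>' \<beta>"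
  by (simp add: vec_eq_iff fmult_component multT_add_left scaleT.scale_right_distrib sum.distrib)

lemma fmult_add_right: "fmult \<Xi> \<alpha> (\<beta> + \<beta>') = fmult \<Xi> \<alpha> \<beta> + fmult \<Xi> \<alpha> \<beta>'"
  by (simp add: vec_eq_iff fmult_component multT_add_right scaleT.scale_right_distrib sum.distrib)

lemma fmult_scale_left: "fmult \<Xi> (fscale z \<alpha>) \<beta> = fscale z (fmult \<Xi> \<alpha> \<beta>)"
  by (simp add: vec_eq_iff fmult_component multT_scale_left scaleT.scale_sum_right mult.commute)

lemma fmult_scale_right: "fmult \<Xi> \<alpha> (fscale z \<beta>) = fscale z (fmult \<Xi> \<alpha> \<beta>)"
  by (simp add: vec_eq_iff fmult_component multT_scale_right scaleT.scale_sum_right mult.commute)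

lemma fmult_zero_left [simp]: "fmult \<Xi> 0 \<beta> = 0"
  using fmult_scale_left[of \<Xi> 0 0 \<beta>] by simp

lemma fmult_zero_right [simp]: "fmult \<Xi> \<alpha> 0 = 0"
  using fmult_scale_right[of \<Xi> \<alpha> 0 0] by simp

lemma fmult_minus_left: "fmult \<Xi> (- \<alpha>) \<beta> = - fmult \<Xi> \<alpha> \<beta>"
  using fmult_scale_left[of \<Xi> "-1" \<alpha> \<beta>] by simp

lemma fmult_minus_right: "fmult \<Xi> \<alpha> (- \<beta>) = - fmult \<Xi> \<alpha> \<beta>"
  using fmult_scale_right[of \<Xi> \<alpha> "-1" \<beta>] by simp

lemma fmult_diff_left: "fmult \<Xi> (\<alpha> - \<alpha>') \<beta> = fmult \<Xi> \<alpha> \<beta> - fmult \<Xi> \<alpha>' \<beta>"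
  using fmult_add_left[of \<Xi> \<alpha> "- \<alpha>'" \<beta>] by (simp add: fmult_minus_left)

lemma fmult_diff_right: "fmult \<Xi> \<alpha> (\<beta> - \<beta>') = fmult \<Xi> \<alpha> \<beta> - fmult \<Xi> \<alpha> \<beta>'"
  using fmult_add_right[of \<Xi> \<alpha> \<beta> "- \<beta>'"] by (simp add: fmult_minus_right)

lemma fmult_sum_left: "fmult \<Xi> (sum f A) \<beta> = (\<Sum>x\<in>A. fmult \<Xi> (f x) \<beta>)"
  by (induction A rule: infinite_finite_induct) (simp_all add: fmult_add_left)

lemma fmult_sum_right: "fmult \<Xi> \<alpha> (sum f A) = (\<Sum>x\<in>A. fmult \<Xi> \<alpha> (f x))"
  by (induction A rule: infinite_finite_induct) (simp_all add: fmult_add_right)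

lemma shuffle_sign_empty_left [simp]: "shuffle_sign {} J = 1"
  by (simp add: shuffle_sign_def)

lemma shuffle_sign_empty_right [simp]: "shuffle_sign I {} = 1"
  by (simp add: shuffle_sign_def)

lemma shuffle_sign_square [simp]: "shuffle_sign I J * shuffle_sign I J = 1"
  by (simp add: shuffle_sign_def flip: power_add mult_2)

lemma shuffle_sign_nonzero [simp]: "shuffle_sign I J \<noteq> 0"
  by (simp add: shuffle_sign_def)

lemma cnj_shuffle_sign [simp]: "cnj (shuffle_sign I J) = shuffle_sign I J"
  by (simp add: shuffle_sign_def)

lemma shuffle_sign_Un_left:
  assumes "I \<inter> J = {}"
  shows "shuffle_sign (I \<union> J) K = shuffle_sign I K * shuffle_sign J K"
proof -
  have "{(i, k). i \<in> I \<union> J \<and> k \<in> K \<and> k < i}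
      = {(i, k). i \<in> I \<and> k \<in> K \<and> k < i} \<union> {(i, k). i \<in> J \<and> k \<in> K \<and> k < i}"
    by auto
  moreover have "card \<dots> = card {(i, k). i \<in> I \<and> k \<in> K \<and> k < i} + card {(i, k). i \<in> J \<and> k \<in> K \<and> k < i}"
    by (rule card_Un_disjoint) (use assms in auto)
  ultimately show ?thesis
    by (simp add: shuffle_sign_def power_add)
qed

lemma shuffle_sign_Un_right:
  assumes "J \<inter> K = {}"
  shows "shuffle_sign I (J \<union> K) = shuffle_sign I J * shuffle_sign I K"
proof -
  have "{(i, k). i \<in> I \<and> k \<in> J \<union> K \<and> k < i}
      = {(i, k). i \<in> I \<and> k \<in> J \<and> k < i} \<union> {(i, k). i \<in> I \<and> k \<in> K \<and> k < i}"
    by auto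
  moreover have "card \<dots> = card {(i, k). i \<in> I \<and> k \<in> J \<and> k < i} + card {(i, k). i \<in> I \<and> k \<in> K \<and> k < i}"
    by (rule card_Un_disjoint) (use assms in auto)
  ultimately show ?thesis
    by (simp add: shuffle_sign_def power_add)
qed

text \<open>
  Every pair in \<open>I \<times> J\<close> is an inversion in exactly one of the two orders.
\<close>

lemma shuffle_sign_swap:
  assumes "I \<inter> J = {}"
  shows "shuffle_sign J I = (- 1) ^ (card I * card J) * shuffle_sign I J"
proof -
  let ?A = "{(i, j). i \<in> I \<and> j \<in> J \<and> j < i}" and ?B = "{(j, i). j \<in> J \<and> i \<in> I \<and> i < j}"
  have "card ?B = card (prod.swap ` ?B)"
    by (simp add: card_image)
  also have "prod.swap ` ?B = {(i, j). i \<in> I \<and> j \<in> J \<and> i < j}"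
    by (auto simp: image_iff)
  finally have "card ?A + card ?B = card (?A \<union> {(i, j). i \<in> I \<and> j \<in> J \<and> i < j})"
    by (simp, subst card_Un_disjoint) auto
  also have "?A \<union> {(i, j). i \<in> I \<and> j \<in> J \<and> i < j} = I \<times> J"
    using assms by (auto simp: linorder_neq_iff)
  finally have "card I * card J = card ?A + card ?B"
    by (simp add: card_cartesian_product)
  then have "(- 1) ^ (card I * card J) * shuffle_sign I J = (shuffle_sign I J * shuffle_sign I J) * shuffle_sign J I"
    by (simp only: shuffle_sign_def power_add mult_ac)
  then show ?thesis
    by simp
qed

text \<open>
  Both sides are sums over the ordered partitions of \<open>K\<close> into \<open>I\<close>, \<open>J\<close> and \<open>K - (I \<union> J)\<close>. The signs agree
  since the shuffle sign is multiplicative over disjoint unions in either argument.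
\<close>

lemma fmult_assoc: "fmult \<Xi> (fmult \<Xi> \<alpha> \<beta>) \<gamma> = fmult \<Xi> \<alpha> (fmult \<Xi> \<beta> \<gamma>)"
proof (simp only: vec_eq_iff, rule allI)
  fix K
  let ?s = shuffle_sign and ?p = "multT \<Xi>"
  let ?t = "\<lambda>L I. scaleT (?s L (K - L) * ?s I (L - I)) (?p (?p (\<alpha> $ I) (\<beta> $ (L - I))) (\<gamma> $ (K - L)))"
  let ?u = "\<lambda>I J. scaleT (?s I (K - I) * ?s J (K - I - J)) (?p (\<alpha> $ I) (?p (\<beta> $ J) (\<gamma> $ (K - I - J))))"
  have "fmult \<Xi> (fmult \<Xi> \<alpha> \<beta>) \<gamma> $ K = (\<Sum>L\<in>Pow K. \<Sum>I\<in>Pow L. ?t L I)"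
    by (simp add: fmult_component multT_sum_left multT_scale_left scaleT.scale_sum_right)
  also have "\<dots> = (\<Sum>(L, I)\<in>Sigma (Pow K) Pow. ?t L I)"
    by (rule sum.Sigma) auto
  also have "\<dots> = (\<Sum>(I, J)\<in>Sigma (Pow K) (\<lambda>I. Pow (K - I)). ?u I J)"
  proof (rule sum.reindex_bij_witness[of _ "\<lambda>(I, J). (I \<union> J, I)" "\<lambda>(L, I). (I, L - I)"]; clarsimp)
    fix L I
    assume LK: "L \<subseteq> K" and IL: "I \<subseteq> L"
    define J where "J = L - I"
    define M where "M = K - L"
    have sets: "L = I \<union> J" "K - I = J \<union> M" "K - I - J = M"
      and disj: "I \<inter> J = {}" "J \<inter> M = {}"
      using LK IL by (auto simp: J_def M_def)
    have "?s I (J \<union> M) * ?s J M = ?s (I \<union> J) M * ?s I J"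
      by (simp add: disj shuffle_sign_Un_left shuffle_sign_Un_right)
    then have "?s I (K - I) * ?s J (K - I - J) = ?s L (K - L) * ?s I (L - I)"
      unfolding J_def[symmetric] M_def[symmetric] using sets by metis
    moreover have "K - I - J = K - L"
      using IL by (auto simp: J_def)
    ultimately show "scaleT (?s I (K - I) * ?s (L - I) (K - I - (L - I)))
          (?p (\<alpha> $ I) (?p (\<beta> $ (L - I)) (\<gamma> $ (K - I - (L - I))))) = ?t L I"
      by (simp add: multT_assoc J_def)
  qed auto
  also have "\<dots> = (\<Sum>I\<in>Pow K. \<Sum>J\<in>Pow (K - I). ?u I J)"
    by (rule sum.Sigma[symmetric]) auto
  also have "\<dots> = fmult \<Xi> \<alpha> (fmult \<Xi> \<beta> \<gamma>) $ K"
    by (simp add: fmult_component multT_sum_right multT_scale_right scaleT.scale_sum_right)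
  finally show "fmult \<Xi> (fmult \<Xi> \<alpha> \<beta>) \<gamma> $ K = fmult \<Xi> \<alpha> (fmult \<Xi> \<beta> \<gamma>) $ K" .
qed

lemma scalar_form_component [simp]: "scalar_form a $ I = (if I = {} then a else 0)"
  by (simp add: scalar_form_def)

lemma scalar_form_add: "scalar_form (a + b) = scalar_form a + scalar_form b"
  by (simp add: vec_eq_iff)

lemma fmult_scalar_left: "fmult \<Xi> (scalar_form a) \<beta> $ K = multT \<Xi> a (\<beta> $ K)"
proof -
  have "fmult \<Xi> (scalar_form a) \<beta> $ K
      = (\<Sum>I\<in>Pow K. if I = {} then multT \<Xi> a (\<beta> $ K) else 0)"
    unfolding fmult_component by (rule sum.cong) auto
  then show ?thesis
    by (simp add: sum.delta)
qed

lemma fmult_scalar_right: "fmult \<Xi> \<alpha> (scalar_form a) $ K = multT \<Xi> (\<alpha> $ K) a"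
proof -
  have "fmult \<Xi> \<alpha> (scalar_form a) $ K
      = (\<Sum>I\<in>Pow K. if I = K then multT \<Xi> (\<alpha> $ K) a else 0)"
    unfolding fmult_component by (rule sum.cong) auto
  then show ?thesis
    by (simp add: sum.delta)
qed

lemma fmult_scalar_scalar: "fmult \<Xi> (scalar_form a) (scalar_form b) = scalar_form (multT \<Xi> a b)"
  by (simp add: vec_eq_iff fmult_scalar_left)

lemma fmult_one_left [simp]: "fmult \<Xi> (scalar_form oneT) \<beta> = \<beta>"
  by (simp add: vec_eq_iff fmult_scalar_left)

lemma fmult_one_right [simp]: "fmult \<Xi> \<alpha> (scalar_form oneT) = \<alpha>"
  by (simp add: vec_eq_iff fmult_scalar_right)

definition homogeneous :: "nat \<Rightarrow> 'n::finite form \<Rightarrow> bool"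
  where "homogeneous k \<alpha> \<longleftrightarrow> (\<forall>I. card I \<noteq> k \<longrightarrow> \<alpha> $ I = 0)"

lemma homogeneous_iff: "homogeneous k \<alpha> \<longleftrightarrow> form_part k \<alpha> = \<alpha>"
  by (auto simp: homogeneous_def form_part_def vec_eq_iff)

lemma form_part_sum: "(\<Sum>k\<le>CARD('n). form_part k \<alpha>) = (\<alpha> :: 'n::finite form)"
proof (simp only: vec_eq_iff, rule allI)
  show "(\<Sum>k\<le>CARD('n). form_part k \<alpha>) $ I = \<alpha> $ I" for I
    using card_mono[of UNIV I] by (simp add: sum_component form_part_def)
qed

lemma homogeneous_add: "homogeneous k \<alpha> \<Longrightarrow> homogeneous k \<beta> \<Longrightarrow> homogeneous k (\<alpha> + \<beta>)"
  by (simp add: homogeneous_def)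

lemma homogeneous_scale: "homogeneous k \<alpha> \<Longrightarrow> homogeneous k (fscale z \<alpha>)"
  by (simp add: homogeneous_def)

lemma homogeneous_mult:
  assumes "homogeneous k \<alpha>" "homogeneous l \<beta>"
  shows "homogeneous (k + l) (fmult \<Xi> \<alpha> \<beta>)"
  unfolding homogeneous_def
proof (intro allI impI)
  fix K :: "'a set"
  assume K: "card K \<noteq> k + l"
  have "multT \<Xi> (\<alpha> $ I) (\<beta> $ (K - I)) = 0" if "I \<subseteq> K" for I
  proof -
    have "card I + card (K - I) = card K"
      using that by (simp add: card_Diff_subset card_mono)
    then have "card I \<noteq> k \<or> card (K - I) \<noteq> l"
      using K by auto
    then have "\<alpha> $ I = 0 \<or> \<beta> $ (K - I) = 0"
      using assms unfolding homogeneous_def by blast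
    then show ?thesis
      by auto
  qed
  then show "fmult \<Xi> \<alpha> \<beta> $ K = 0"
    by (simp add: fmult_component)
qed

lemma homogeneous_diff:
  assumes "homogeneous k \<alpha>"
  shows "homogeneous (Suc k) (fdiff \<alpha>)"
  unfolding homogeneous_def
proof (intro allI impI)
  fix K :: "'a set"
  assume K: "card K \<noteq> Suc k"
  have "\<alpha> $ (K - {j}) = 0" if "j \<in> K" for j
  proof -
    have "card (K - {j}) \<noteq> k"
      using K that card_Suc_Diff1[of K j] by auto
    then show ?thesis
      using assms unfolding homogeneous_def by blast
  qed
  then show "fdiff \<alpha> $ K = 0"
    by (simp add: fdiff_def)
qed

lemma homogeneous_hodge:
  fixes \<alpha> :: "'n::{finite,linorder} form"
  assumes "homogeneous k \<alpha>"
  shows "homogeneous (CARD('n) - k) (hodge \<alpha>)"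
  unfolding homogeneous_def
proof (intro allI impI)
  fix K :: "'n set"
  assume "card K \<noteq> CARD('n) - k"
  then have "card (- K) \<noteq> k"
    using card_mono[of UNIV K] by (auto simp: Compl_eq_Diff_UNIV card_Diff_subset)
  then show "hodge \<alpha> $ K = 0"
    using assms by (simp add: homogeneous_def hodge_def)
qed

lemma degree_sign_component: "degree_sign k \<alpha> $ I = scaleT ((- 1) ^ (k * card I)) (\<alpha> $ I)"
  by (simp add: degree_sign_def)

lemma degree_sign_0 [simp]: "degree_sign 0 \<alpha> = \<alpha>"
  by (simp add: vec_eq_iff degree_sign_component)

lemma degree_sign_1_twice [simp]: "degree_sign (Suc 0) (degree_sign (Suc 0) \<alpha>) = \<alpha>"
  by (simp add: vec_eq_iff degree_sign_component flip: power_add mult_2)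

lemma degree_sign_one [simp]: "degree_sign k (scalar_form oneT) = scalar_form oneT"
  by (simp add: vec_eq_iff degree_sign_component)

lemma degree_sign_add: "degree_sign k (\<alpha> + \<beta>) = degree_sign k \<alpha> + degree_sign k \<beta>"
  by (simp add: vec_eq_iff degree_sign_component scaleT.scale_right_distrib)

lemma degree_sign_zero [simp]: "degree_sign k 0 = 0"
  by (simp add: vec_eq_iff degree_sign_component)

lemma degree_sign_homogeneous_1:
  assumes "homogeneous 1 \<alpha>"
  shows "degree_sign 1 \<alpha> = - \<alpha>"
proof (simp only: vec_eq_iff, rule allI)
  show "degree_sign 1 \<alpha> $ I = (- \<alpha>) $ I" for I
    using assms by (cases "card I = 1") (simp_all add: degree_sign_component homogeneous_def)
qed

lemma degree_sign_scale: "degree_sign k (fscale z \<alpha>) = fscale z (degree_sign k \<alpha>)"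
  by (simp add: vec_eq_iff degree_sign_component mult.commute)

section \<open>The involution on forms\<close>

lemma fstar_component [simp]: "fstar \<Xi> \<alpha> $ I = starT \<Xi> (\<alpha> $ I)"
  by (simp add: fstar_def)

lemma fstar_star [simp]: "fstar \<Xi> (fstar \<Xi> \<alpha>) = \<alpha>"
  by (simp add: vec_eq_iff)

lemma fstar_add: "fstar \<Xi> (\<alpha> + \<beta>) = fstar \<Xi> \<alpha> + fstar \<Xi> \<beta>"
  by (simp add: vec_eq_iff starT_add)

lemma fstar_scale: "fstar \<Xi> (fscale z \<alpha>) = fscale (cnj z) (fstar \<Xi> \<alpha>)"
  by (simp add: vec_eq_iff starT_scale)

lemma fstar_minus: "fstar \<Xi> (- \<alpha>) = - fstar \<Xi> \<alpha>"
  using fstar_scale[of \<Xi> "-1" \<alpha>] by simp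

lemma fstar_diff: "fstar \<Xi> (\<alpha> - \<beta>) = fstar \<Xi> \<alpha> - fstar \<Xi> \<beta>"
  using fstar_add[of \<Xi> \<alpha> "- \<beta>"] by (simp add: fstar_minus)

lemma fstar_zero [simp]: "fstar \<Xi> 0 = 0"
  by (simp add: vec_eq_iff)

lemma fstar_eq_0_iff [simp]: "fstar \<Xi> \<alpha> = 0 \<longleftrightarrow> \<alpha> = 0"
  by (metis fstar_star fstar_zero)

lemma fstar_scalar: "fstar \<Xi> (scalar_form a) = scalar_form (starT \<Xi> a)"
  by (simp add: vec_eq_iff)

lemma fstar_degree_sign: "fstar \<Xi> (degree_sign k \<alpha>) = degree_sign k (fstar \<Xi> \<alpha>)"
  by (simp add: vec_eq_iff degree_sign_component starT_scale)

lemma fstar_mult_component: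
  "fstar \<Xi> (fmult \<Xi> \<alpha> \<beta>) $ K = (\<Sum>J\<in>Pow K. scaleT ((- 1) ^ (card J * card (K - J)) * shuffle_sign J (K - J))
      (multT \<Xi> (starT \<Xi> (\<beta> $ J)) (starT \<Xi> (\<alpha> $ (K - J)))))"
proof -
  have "fstar \<Xi> (fmult \<Xi> \<alpha> \<beta>) $ K = (\<Sum>I\<in>Pow K. scaleT (shuffle_sign I (K - I))
      (multT \<Xi> (starT \<Xi> (\<beta> $ (K - I))) (starT \<Xi> (\<alpha> $ I))))"
    by (simp add: fmult_component starT_sum starT_scale starT_mult)
  also have "\<dots> = (\<Sum>J\<in>Pow K. scaleT ((- 1) ^ (card J * card (K - J)) * shuffle_sign J (K - J))
      (multT \<Xi> (starT \<Xi> (\<beta> $ J)) (starT \<Xi> (\<alpha> $ (K - J)))))"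
  proof (rule sum.reindex_bij_witness[of _ "\<lambda>J. K - J" "\<lambda>I. K - I"])
    fix I
    assume "I \<in> Pow K"
    then have KI: "K - (K - I) = I"
      by auto
    show "scaleT ((- 1) ^ (card (K - I) * card (K - (K - I))) * shuffle_sign (K - I) (K - (K - I)))
          (multT \<Xi> (starT \<Xi> (\<beta> $ (K - I))) (starT \<Xi> (\<alpha> $ (K - (K - I)))))
        = scaleT (shuffle_sign I (K - I)) (multT \<Xi> (starT \<Xi> (\<beta> $ (K - I))) (starT \<Xi> (\<alpha> $ I)))"
      unfolding KI using shuffle_sign_swap[of "K - I" I] by (simp add: Int_commute)
  qed auto
  finally show ?thesis .
qed

text \<open>
  The graded rule for the adjoint of a product. Only one factor has to be homogeneous: the sign can be put
  on the components of the other one.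
\<close>

lemma fstar_mult_homogeneous_left:
  assumes "homogeneous k \<alpha>"
  shows "fstar \<Xi> (fmult \<Xi> \<alpha> \<beta>) = fmult \<Xi> (degree_sign k (fstar \<Xi> \<beta>)) (fstar \<Xi> \<alpha>)"
proof (simp only: vec_eq_iff, rule allI)
  fix K
  have sign: "scaleT ((- 1) ^ (card J * card (K - J))) (multT \<Xi> b (starT \<Xi> (\<alpha> $ (K - J))))
      = scaleT ((- 1) ^ (k * card J)) (multT \<Xi> b (starT \<Xi> (\<alpha> $ (K - J))))" for J b
    using assms by (cases "card (K - J) = k") (auto simp: homogeneous_def mult.commute)
  show "fstar \<Xi> (fmult \<Xi> \<alpha> \<beta>) $ K = fmult \<Xi> (degree_sign k (fstar \<Xi> \<beta>)) (fstar \<Xi> \<alpha>) $ K"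
    unfolding fstar_mult_component unfolding fmult_component degree_sign_component multT_scale_left fstar_component
    by (simp only: mult.commute[of "(- 1) ^ m" for m] scaleT.scale_scale[symmetric] sign)
qed

lemma fstar_mult_homogeneous_right:
  assumes "homogeneous k \<beta>"
  shows "fstar \<Xi> (fmult \<Xi> \<alpha> \<beta>) = fmult \<Xi> (fstar \<Xi> \<beta>) (degree_sign k (fstar \<Xi> \<alpha>))"
proof (simp only: vec_eq_iff, rule allI)
  fix K
  have sign: "scaleT ((- 1) ^ (card J * card (K - J))) (multT \<Xi> (starT \<Xi> (\<beta> $ J)) a)
      = scaleT ((- 1) ^ (k * card (K - J))) (multT \<Xi> (starT \<Xi> (\<beta> $ J)) a)" for J a
    using assms by (cases "card J = k") (auto simp: homogeneous_def)
  show "fstar \<Xi> (fmult \<Xi> \<alpha> \<beta>) $ K = fmult \<Xi> (fstar \<Xi> \<beta>) (degree_sign k (fstar \<Xi> \<alpha>)) $ K"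
    unfolding fstar_mult_component unfolding fmult_component degree_sign_component multT_scale_right fstar_component
    by (simp only: mult.commute[of "(- 1) ^ m" for m] scaleT.scale_scale[symmetric] sign)
qed

section \<open>The exterior derivative\<close>

text \<open>
  The one-form \<open>d\<U>\<^sub>j\<close>.
\<close>

definition frame_form :: "'n::finite \<Rightarrow> 'n form"
  where "frame_form j = (\<chi> I. if I = {j} then oneT else 0)"

definition fderiv :: "'n::finite \<Rightarrow> 'n form \<Rightarrow> 'n form"
  where "fderiv j \<alpha> = (\<chi> I. derivT j (\<alpha> $ I))"

lemma fmult_frame_left:
  "fmult \<Xi> (frame_form j) \<alpha> $ K = (if j \<in> K then scaleT (shuffle_sign {j} (K - {j})) (\<alpha> $ (K - {j})) else 0)"
proof -
  have "fmult \<Xi> (frame_form j) \<alpha> $ K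
      = (\<Sum>I\<in>Pow K. if I = {j} then scaleT (shuffle_sign {j} (K - {j})) (\<alpha> $ (K - {j})) else 0)"
    unfolding fmult_component by (rule sum.cong) (auto simp: frame_form_def)
  then show ?thesis
    by (simp add: sum.delta)
qed

text \<open>
  The coefficients of \<open>d\<U>\<^sub>j\<close> are central, so only the wedge sign is left.
\<close>

lemma fmult_frame_commute: "fmult \<Xi> (frame_form j) \<alpha> = fmult \<Xi> (degree_sign 1 \<alpha>) (frame_form j)"
proof (simp only: vec_eq_iff, rule allI)
  fix K
  have complement: "K - I = {j} \<longleftrightarrow> j \<in> K \<and> I = K - {j}" if "I \<subseteq> K" for I
    using that by auto
  have double: "K - (K - {j}) = {j}" if "j \<in> K"
    using that by auto
  \<comment> \<open>moving \<open>j\<close> past the remaining indices, one transposition for each of them\<close>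
  have sign: "(- 1) ^ card (K - {j}) * shuffle_sign (K - {j}) {j} = shuffle_sign {j} (K - {j})"
    using shuffle_sign_swap[of "K - {j}" "{j}"] by simp
  have "fmult \<Xi> (degree_sign 1 \<alpha>) (frame_form j) $ K
      = (\<Sum>I\<in>Pow K. if I = K - {j} then
          (if j \<in> K then scaleT (shuffle_sign {j} (K - {j})) (\<alpha> $ (K - {j})) else 0) else 0)"
    unfolding fmult_component
    by (rule sum.cong)
       (auto simp: frame_form_def degree_sign_component complement double multT_scale_left mult.commute sign[symmetric])
  also have "\<dots> = fmult \<Xi> (frame_form j) \<alpha> $ K"
    by (subst sum.delta) (auto simp: fmult_frame_left)
  finally show "fmult \<Xi> (frame_form j) \<alpha> $ K = fmult \<Xi> (degree_sign 1 \<alpha>) (frame_form j) $ K" ..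
qed

text \<open>
  This form of \<open>d\<close> separates the derivations \<open>\<delta>\<^sub>j\<close>, which obey the ungraded Leibniz rule, from the graded
  central elements \<open>d\<U>\<^sub>j\<close>. With it the graded Leibniz rule follows from associativity.
\<close>

lemma fdiff_eq_sum: "fdiff \<alpha> = fscale \<i> (\<Sum>j\<in>UNIV. fmult \<Xi> (frame_form j) (fderiv j \<alpha>))"
  by (simp add: vec_eq_iff sum_component fdiff_def fmult_frame_left fderiv_def scaleT.scale_sum_right
      if_distrib[of "scaleT _"] sum.If_cases cong: if_cong)

lemma fderiv_mult: "fderiv j (fmult \<Xi> \<alpha> \<beta>) = fmult \<Xi> (fderiv j \<alpha>) \<beta> + fmult \<Xi> \<alpha> (fderiv j \<beta>)"
  by (simp add: vec_eq_iff fderiv_def fmult_component derivT_sum derivT_scale derivT_mult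
      scaleT.scale_right_distrib sum.distrib)

lemma fdiff_one [simp]: "fdiff (scalar_form oneT) = 0"
  by (simp add: vec_eq_iff fdiff_def if_distrib[of "derivT _"] cong: if_cong)

lemma fdiff_mult: "fdiff (fmult \<Xi> \<alpha> \<beta>) = fmult \<Xi> (fdiff \<alpha>) \<beta> + fmult \<Xi> (degree_sign 1 \<alpha>) (fdiff \<beta>)"
proof -
  have "fmult \<Xi> (frame_form j) (fmult \<Xi> \<alpha> \<gamma>) = fmult \<Xi> (degree_sign 1 \<alpha>) (fmult \<Xi> (frame_form j) \<gamma>)" for j \<gamma>
    by (metis fmult_assoc fmult_frame_commute)
  then show ?thesis
    by (simp add: fdiff_eq_sum[of _ \<Xi>] fderiv_mult fmult_add_right sum.distrib fscale.scale_right_distrib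
        fmult_sum_left fmult_sum_right fmult_scale_left fmult_scale_right fmult_assoc)
qed

lemma fdiff_add: "fdiff (\<alpha> + \<beta>) = fdiff \<alpha> + fdiff \<beta>"
  by (simp add: vec_eq_iff fdiff_def derivT_add scaleT.scale_right_distrib sum.distrib)

lemma fdiff_scale: "fdiff (fscale z \<alpha>) = fscale z (fdiff \<alpha>)"
  by (simp add: vec_eq_iff fdiff_def derivT_scale scaleT.scale_sum_right mult_ac)

lemma fdiff_zero [simp]: "fdiff 0 = 0"
  using fdiff_scale[of 0 0] by simp

lemma fdiff_star: "fdiff (fstar \<Xi> \<alpha>) = - fstar \<Xi> (fdiff \<alpha>)"
  by (simp add: vec_eq_iff fdiff_def derivT_star starT_sum starT_scale sum_negf)

section \<open>Integration and the Hodge operator\<close>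

text \<open>
  The integral of forms without its normalising factor.
\<close>

definition top_trace :: "'n::finite form \<Rightarrow> complex"
  where "top_trace \<alpha> = tau0 (\<alpha> $ UNIV)"

lemma top_trace_add: "top_trace (\<alpha> + \<beta>) = top_trace \<alpha> + top_trace \<beta>"
  by (simp add: top_trace_def tau0_add)

lemma top_trace_scale: "top_trace (fscale z \<alpha>) = z * top_trace \<alpha>"
  by (simp add: top_trace_def tau0_scale)

lemma top_trace_minus: "top_trace (- \<alpha>) = - top_trace \<alpha>"
  by (simp add: top_trace_def tau0_minus)

lemma top_trace_diff: "top_trace (\<alpha> - \<beta>) = top_trace \<alpha> - top_trace \<beta>"
  using top_trace_add[of \<alpha> "- \<beta>"] by (simp add: top_trace_minus)

lemma top_trace_fdiff: "top_trace (fdiff \<alpha>) = 0"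
  by (simp add: top_trace_def fdiff_def tau0_sum tau0_scale tau0_deriv)

lemma top_trace_mult:
  "top_trace (fmult \<Xi> \<alpha> \<beta>) = (\<Sum>I\<in>UNIV. shuffle_sign I (- I) * tau0 (multT \<Xi> (\<alpha> $ I) (\<beta> $ (- I))))"
  by (simp add: top_trace_def fmult_component tau0_sum tau0_scale Compl_eq_Diff_UNIV)

lemma card_Compl_UNIV: "card (- (I :: 'n::finite set)) = CARD('n) - card I"
  by (simp add: Compl_eq_Diff_UNIV card_Diff_subset)

text \<open>
  The integral is a graded trace: \<open>\<tau>\<^sub>0\<close> is a trace, and the wedge factors of complementary degrees commute up
  to the sign \<open>(-1)\<^sup>k\<^sup>(\<^sup>n\<^sup>-\<^sup>k\<^sup>)\<close>.
\<close>

lemma top_trace_graded_commute: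
  fixes \<alpha> \<beta> :: "'n::{finite,linorder} form"
  assumes "homogeneous k \<alpha>"
  shows "top_trace (fmult \<Xi> \<alpha> \<beta>) = (- 1) ^ (k * (CARD('n) - k)) * top_trace (fmult \<Xi> \<beta> \<alpha>)"
proof -
  have "top_trace (fmult \<Xi> \<alpha> \<beta>)
      = (\<Sum>J\<in>UNIV. (- 1) ^ (k * (CARD('n) - k)) * (shuffle_sign J (- J) * tau0 (multT \<Xi> (\<beta> $ J) (\<alpha> $ (- J)))))"
    unfolding top_trace_mult
  proof (rule sum.reindex_bij_witness[of _ uminus uminus])
    fix I :: "'n set"
    show "(- 1) ^ (k * (CARD('n) - k)) * (shuffle_sign (- I) (- (- I)) * tau0 (multT \<Xi> (\<beta> $ (- I)) (\<alpha> $ (- (- I)))))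
        = shuffle_sign I (- I) * tau0 (multT \<Xi> (\<alpha> $ I) (\<beta> $ (- I)))"
    proof (cases "card I = k")
      case True
      have "shuffle_sign I (- I) = (- 1) ^ (k * (CARD('n) - k)) * shuffle_sign (- I) I"
        using shuffle_sign_swap[of "- I" I] True by (simp add: card_Compl_UNIV mult.commute)
      then show ?thesis
        by (simp add: tau0_mult_commute[of \<Xi> "\<alpha> $ I"])
    next
      case False
      then show ?thesis
        using assms by (simp add: homogeneous_def)
    qed
  qed auto
  then show ?thesis
    by (simp add: top_trace_mult sum_distrib_left)
qed

text \<open>
  Against a form of degree \<open>n - 1\<close> only the components of degree \<open>1\<close> contribute to the integral.
\<close>

lemma top_trace_degree_sign:
  fixes \<alpha> \<beta> :: "'n::{finite,linorder} form"
  assumes "homogeneous (CARD('n) - 1) \<beta>"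
  shows "top_trace (fmult \<Xi> (degree_sign 1 \<alpha>) \<beta>) = - top_trace (fmult \<Xi> \<alpha> \<beta>)"
proof -
  have "\<beta> $ (- I) = 0" if "card I \<noteq> 1" for I
  proof -
    have "card (- I) \<noteq> CARD('n) - 1"
      using that card_mono[of UNIV I] by (simp add: card_Compl_UNIV)
        (metis diff_diff_cancel zero_less_card_finite Suc_leI)
    then show ?thesis
      using assms by (simp add: homogeneous_def)
  qed
  then have "shuffle_sign I (- I) * tau0 (multT \<Xi> (degree_sign 1 \<alpha> $ I) (\<beta> $ (- I)))
      = - (shuffle_sign I (- I) * tau0 (multT \<Xi> (\<alpha> $ I) (\<beta> $ (- I))))" for I
    by (cases "card I = 1") (simp_all add: degree_sign_component multT_minus_left tau0_minus)
  then show ?thesis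
    by (simp only: top_trace_mult sum_negf)
qed

lemma top_trace_nondegenerate:
  assumes "\<And>\<alpha>. top_trace (fmult \<Xi> \<alpha> \<beta>) = 0"
  shows "\<beta> = 0"
proof (simp only: vec_eq_iff, rule allI)
  fix K
  have "tau0 (multT \<Xi> (\<beta> $ K) a) = 0" for a
  proof -
    define \<alpha> where "\<alpha> = (\<chi> I. if I = - K then a else 0)"
    have "0 = (\<Sum>I\<in>UNIV. shuffle_sign I (- I) * tau0 (multT \<Xi> (\<alpha> $ I) (\<beta> $ (- I))))"
      using assms[of \<alpha>] by (simp add: top_trace_mult)
    also have "\<dots> = (\<Sum>I\<in>UNIV. if I = - K then shuffle_sign (- K) K * tau0 (multT \<Xi> a (\<beta> $ K)) else 0)"
      by (rule sum.cong) (auto simp: \<alpha>_def)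
    finally show ?thesis
      by (simp add: sum.delta tau0_mult_commute[of \<Xi> a])
  qed
  then show "\<beta> $ K = 0 $ K"
    using tau0_nondegenerate by auto
qed

lemma hodge_component [simp]: "hodge \<alpha> $ K = scaleT (shuffle_sign (- K) K) (\<alpha> $ (- K))"
  by (simp add: hodge_def)

lemma hodge_surjective: obtains \<alpha> where "hodge \<alpha> = \<beta>"
proof
  show "hodge (\<chi> I. scaleT (shuffle_sign I (- I)) (\<beta> $ (- I))) = \<beta>"
    by (simp add: vec_eq_iff)
qed

lemma hodge_eq_0_iff: "hodge \<alpha> = 0 \<longleftrightarrow> \<alpha> = 0"
proof
  assume h: "hodge \<alpha> = 0"
  have "scaleT (shuffle_sign I (- I)) (\<alpha> $ I) = 0" for I
    using arg_cong[OF h, of "\<lambda>\<beta>. \<beta> $ (- I)"] by simp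
  then show "\<alpha> = 0"
    by (simp add: vec_eq_iff)
qed (simp add: vec_eq_iff)

lemma hodge_minus: "hodge (- \<alpha>) = - hodge \<alpha>"
  by (simp add: vec_eq_iff)

lemma hodge_diff: "hodge (\<alpha> - \<beta>) = hodge \<alpha> - hodge \<beta>"
  by (simp add: vec_eq_iff scaleT.scale_right_diff_distrib)

text \<open>
  The two signs of the Hodge operator and of the wedge product cancel, so the inner product is
  diagonal in the wedge products of the \<open>d\<U>\<^sub>j\<close>.
\<close>

lemma form_inner_eq_sum:
  fixes \<alpha> \<beta> :: "'n::{finite,linorder} form"
  shows "form_inner c \<Xi> \<alpha> \<beta> = of_real c * (\<Sum>I\<in>UNIV. tau0 (multT \<Xi> (starT \<Xi> (\<alpha> $ I)) (\<beta> $ I)))"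
proof -
  let ?t = "\<lambda>I. tau0 (multT \<Xi> (starT \<Xi> (\<alpha> $ I)) (\<beta> $ I))"
  have "form_integral c (fmult \<Xi> (fstar \<Xi> (form_part k \<alpha>)) (hodge (form_part k \<beta>)))
      = of_real c * (\<Sum>I\<in>UNIV. if card I = k then ?t I else 0)" for k
    unfolding form_integral_def top_trace_def[symmetric] top_trace_mult
    by (intro arg_cong2[where f = "(*)"] sum.cong)
       (auto simp: form_part_def multT_scale_right tau0_scale simp flip: mult.assoc)
  then have "form_inner c \<Xi> \<alpha> \<beta> = of_real c * (\<Sum>k\<le>CARD('n). \<Sum>I\<in>UNIV. if card I = k then ?t I else 0)"
    by (simp add: form_inner_def sum_distrib_left)
  also have "(\<Sum>k\<le>CARD('n). \<Sum>I\<in>UNIV. if card I = k then ?t I else 0)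
      = (\<Sum>I\<in>UNIV. \<Sum>k\<le>CARD('n). if card I = k then ?t I else 0)"
    by (rule sum.swap)
  also have "\<dots> = (\<Sum>I\<in>UNIV. ?t I)"
    by (simp add: card_mono)
  finally show ?thesis .
qed

text \<open>
  By the trace property the Hodge operator may be put on the first form instead of the second one. In this
  shape an operator that acts on the second form can be moved to the first one by integration by parts.
\<close>

lemma form_inner_eq_top_trace: "form_inner c \<Xi> \<alpha> \<beta> = of_real c * top_trace (fmult \<Xi> \<beta> (hodge (fstar \<Xi> \<alpha>)))"
  unfolding form_inner_eq_sum top_trace_mult
  by (intro arg_cong2[where f = "(*)"] sum.cong refl)
     (simp add: multT_scale_right tau0_scale tau0_mult_commute[of \<Xi> "starT _ _"] flip: mult.assoc)

lemma form_inner_add_right: "form_inner c \<Xi> \<alpha> (\<beta> + \<beta>') = form_inner c \<Xi> \<alpha> \<beta> + form_inner c \<Xi> \<alpha> \<beta>'"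
  by (simp add: form_inner_eq_top_trace fmult_add_left top_trace_add algebra_simps)

lemma form_inner_zero_left [simp]: "form_inner c \<Xi> 0 \<beta> = 0"
  by (simp add: form_inner_eq_sum)

lemma form_inner_zero_right [simp]: "form_inner c \<Xi> \<alpha> 0 = 0"
  by (simp add: form_inner_eq_sum)

lemma form_inner_add_left: "form_inner c \<Xi> (\<alpha> + \<alpha>') \<beta> = form_inner c \<Xi> \<alpha> \<beta> + form_inner c \<Xi> \<alpha>' \<beta>"
  by (simp add: form_inner_eq_sum starT_add multT_add_left tau0_add sum.distrib distrib_left)

lemma form_inner_scale_left: "form_inner c \<Xi> (fscale z \<alpha>) \<beta> = cnj z * form_inner c \<Xi> \<alpha> \<beta>"
  by (simp add: form_inner_eq_sum starT_scale multT_scale_left tau0_scale sum_distrib_left mult.left_commute)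

lemma form_inner_scale_right: "form_inner c \<Xi> \<alpha> (fscale z \<beta>) = z * form_inner c \<Xi> \<alpha> \<beta>"
  by (simp add: form_inner_eq_sum multT_scale_right tau0_scale sum_distrib_left mult.left_commute)

lemma form_inner_sum_left: "form_inner c \<Xi> (sum f A) \<beta> = (\<Sum>x\<in>A. form_inner c \<Xi> (f x) \<beta>)"
  by (induction A rule: infinite_finite_induct) (simp_all add: form_inner_add_left)

lemma form_inner_sum_right: "form_inner c \<Xi> \<alpha> (sum f A) = (\<Sum>x\<in>A. form_inner c \<Xi> \<alpha> (f x))"
  by (induction A rule: infinite_finite_induct) (simp_all add: form_inner_add_right)

text \<open>
  This adjunction makes the pairing on \<open>E \<otimes> \<Omega>\<close> depend only on the forms to which tensors contract.
\<close>

lemma form_inner_scalar: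
  "form_inner c \<Xi> \<alpha> (fmult \<Xi> (scalar_form (multT \<Xi> (starT \<Xi> a) b)) \<beta>)
    = form_inner c \<Xi> (fmult \<Xi> (scalar_form a) \<alpha>) (fmult \<Xi> (scalar_form b) \<beta>)"
  by (simp add: form_inner_eq_sum fmult_scalar_left starT_mult multT_assoc)

section \<open>The covariant derivative and integration by parts\<close>

text \<open>
  The differential plus the graded commutator with \<open>\<mu>\<close>; \<open>degree_sign 1\<close> is the grading automorphism, so the
  formula covers inhomogeneous forms.
\<close>

definition covariant_diff :: "'n::{finite,linorder} rmatrix \<Rightarrow> 'n form \<Rightarrow> 'n form \<Rightarrow> 'n form"
  where "covariant_diff \<Xi> \<mu> \<nu> = fdiff \<nu> + fmult \<Xi> \<mu> \<nu> - fmult \<Xi> (degree_sign 1 \<nu>) \<mu>"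

text \<open>
  For the curvature form \<open>F\<close> of \<open>\<mu>\<close> this is \<open>d \<star>F + \<mu> \<star>F + (-1)\<^sup>n\<^sup>-\<^sup>1 \<star>F \<mu>\<close>.
\<close>

definition yang_mills_form :: "'n::{finite,linorder} rmatrix \<Rightarrow> 'n form \<Rightarrow> 'n form"
  where "yang_mills_form \<Xi> \<mu> =
    (let \<beta> = hodge (fdiff \<mu> + fmult \<Xi> \<mu> \<mu>) in
      fdiff \<beta> + fmult \<Xi> \<mu> \<beta> + fscale ((- 1) ^ (CARD('n) - 1)) (fmult \<Xi> \<beta> \<mu>))"

text \<open>
  Conjugation by the involution reverses the sign of \<open>d\<close>. It also exchanges the two terms of the graded
  commutator with the hermitian one-form \<open>\<mu>\<close>, which again gives a sign.
\<close>

lemma fstar_covariant_diff_star: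
  assumes "homogeneous 1 \<mu>" "fstar \<Xi> \<mu> = \<mu>"
  shows "fstar \<Xi> (covariant_diff \<Xi> \<mu> (fstar \<Xi> \<nu>)) = - covariant_diff \<Xi> \<mu> \<nu>"
  using fstar_mult_homogeneous_left[OF assms(1), of \<Xi> "fstar \<Xi> \<nu>"]
    fstar_mult_homogeneous_right[OF assms(1), of \<Xi> "degree_sign 1 (fstar \<Xi> \<nu>)"]
  by (simp add: covariant_diff_def fdiff_star fstar_add fstar_diff fstar_minus assms(2) fstar_degree_sign)

lemma homogeneous_curvature:
  assumes "homogeneous 1 \<mu>"
  shows "homogeneous 2 (fdiff \<mu> + fmult \<Xi> \<mu> \<mu>)"
  using homogeneous_diff[OF assms] homogeneous_mult[OF assms assms, of \<Xi>]
  by (intro homogeneous_add) (simp_all add: numeral_2_eq_2)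

text \<open>
  The curvature form is antihermitian: \<open>(d\<mu>)\<^sup>* = - d(\<mu>\<^sup>*)\<close>, and the involution reverses products of one-forms
  with a sign.
\<close>

lemma fstar_curvature:
  assumes "homogeneous 1 \<mu>" "fstar \<Xi> \<mu> = \<mu>"
  shows "fstar \<Xi> (fdiff \<mu> + fmult \<Xi> \<mu> \<mu>) = - (fdiff \<mu> + fmult \<Xi> \<mu> \<mu>)"
proof -
  have "degree_sign 1 \<mu> = - \<mu>"
    using assms(1) by (rule degree_sign_homogeneous_1)
  then have "fstar \<Xi> (fmult \<Xi> \<mu> \<mu>) = - fmult \<Xi> \<mu> \<mu>"
    using fstar_mult_homogeneous_left[OF assms(1), of \<Xi> \<mu>] by (simp add: assms(2) fmult_minus_left)
  moreover have "fstar \<Xi> (fdiff \<mu>) = - fdiff \<mu>"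
    using fdiff_star[of \<Xi> \<mu>] by (simp add: assms(2) equation_minus_iff)
  ultimately show ?thesis
    by (simp add: fstar_add)
qed

lemma homogeneous_yang_mills_form:
  fixes \<mu> :: "'n::{finite,linorder} form"
  assumes "CARD('n) \<ge> 2" "homogeneous 1 \<mu>"
  shows "homogeneous (CARD('n) - 1) (yang_mills_form \<Xi> \<mu>)"
proof -
  let ?\<beta> = "hodge (fdiff \<mu> + fmult \<Xi> \<mu> \<mu>)"
  have \<beta>: "homogeneous (CARD('n) - 2) ?\<beta>"
    by (intro homogeneous_hodge homogeneous_curvature assms(2))
  have n: "Suc (CARD('n) - 2) = CARD('n) - 1" "1 + (CARD('n) - 2) = CARD('n) - 1" "CARD('n) - 2 + 1 = CARD('n) - 1"
    using assms(1) by auto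
  have "homogeneous (CARD('n) - 1) (fdiff ?\<beta>)"
    using homogeneous_diff[OF \<beta>] unfolding n .
  moreover have "homogeneous (CARD('n) - 1) (fmult \<Xi> \<mu> ?\<beta>)"
    using homogeneous_mult[OF assms(2) \<beta>] unfolding n .
  moreover have "homogeneous (CARD('n) - 1) (fmult \<Xi> ?\<beta> \<mu>)"
    using homogeneous_mult[OF \<beta> assms(2)] unfolding n .
  ultimately show ?thesis
    unfolding yang_mills_form_def Let_def by (intro homogeneous_add homogeneous_scale)
qed

text \<open>
  The operator \<open>d + [\<mu>, -]\<close> is integrated by parts. The first term moves by the Leibniz rule since exact
  forms have integral zero, the left multiplication by \<open>\<mu>\<close> moves by the graded trace property with the sign
  \<open>(-1)\<^sup>n\<^sup>-\<^sup>1\<close>, and the right multiplication moves by associativity.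
\<close>

lemma top_trace_covariant_diff:
  fixes \<mu> \<nu> :: "'n::{finite,linorder} form"
  assumes "CARD('n) \<ge> 2" "homogeneous 1 \<mu>"
  shows "top_trace (fmult \<Xi> (covariant_diff \<Xi> \<mu> \<nu>) (hodge (fdiff \<mu> + fmult \<Xi> \<mu> \<mu>)))
    = top_trace (fmult \<Xi> \<nu> (yang_mills_form \<Xi> \<mu>))"
proof -
  let ?\<beta> = "hodge (fdiff \<mu> + fmult \<Xi> \<mu> \<mu>)" and ?\<epsilon> = "degree_sign 1 \<nu>"
  let ?s = "(- 1) ^ (CARD('n) - 1) :: complex"
  have "homogeneous (CARD('n) - 2) ?\<beta>"
    by (intro homogeneous_hodge homogeneous_curvature assms(2))
  then have \<beta>\<mu>: "homogeneous (CARD('n) - 1) (fmult \<Xi> ?\<beta> \<mu>)"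
    using homogeneous_mult[OF _ assms(2), of "CARD('n) - 2" ?\<beta> \<Xi>] assms(1)
    by (simp add: eval_nat_numeral Suc_diff_Suc)
  have d: "top_trace (fmult \<Xi> (fdiff \<nu>) ?\<beta>) = - top_trace (fmult \<Xi> ?\<epsilon> (fdiff ?\<beta>))"
    using top_trace_fdiff[of "fmult \<Xi> \<nu> ?\<beta>"]
    by (simp add: fdiff_mult top_trace_add add_eq_0_iff)
  have "top_trace (fmult \<Xi> (fmult \<Xi> \<mu> \<nu>) ?\<beta>) = ?s * top_trace (fmult \<Xi> \<nu> (fmult \<Xi> ?\<beta> \<mu>))"
    using top_trace_graded_commute[OF assms(2), of \<Xi> "fmult \<Xi> \<nu> ?\<beta>"] by (simp only: fmult_assoc mult_1)
  then have l: "top_trace (fmult \<Xi> (fmult \<Xi> \<mu> \<nu>) ?\<beta>) = - ?s * top_trace (fmult \<Xi> ?\<epsilon> (fmult \<Xi> ?\<beta> \<mu>))"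
    unfolding top_trace_degree_sign[OF \<beta>\<mu>] by simp
  have "top_trace (fmult \<Xi> (covariant_diff \<Xi> \<mu> \<nu>) ?\<beta>) = - top_trace (fmult \<Xi> ?\<epsilon> (yang_mills_form \<Xi> \<mu>))"
    unfolding covariant_diff_def yang_mills_form_def Let_def
    by (simp only: fmult_add_left fmult_diff_left fmult_add_right fmult_scale_right top_trace_add top_trace_diff
        top_trace_scale d l fmult_assoc[of _ ?\<epsilon>]) (simp add: algebra_simps)
  also have "\<dots> = top_trace (fmult \<Xi> \<nu> (yang_mills_form \<Xi> \<mu>))"
    using top_trace_degree_sign[OF homogeneous_yang_mills_form[OF assms]] by simp
  finally show ?thesis .
qed

section \<open>Forms on the bundle\<close>

abbreviation (input) psingle where "psingle \<equiv> Poly_Mapping.single"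
abbreviation (input) pkeys where "pkeys \<equiv> Poly_Mapping.keys"
abbreviation (input) plookup where "plookup \<equiv> Poly_Mapping.lookup"

text \<open>
  The operations on forms of the bundle are sums over supports. To see that they are additive, the supports
  have to be enlarged to a common finite set.
\<close>

lemma sum_keys_superset:
  assumes "finite S" "pkeys x \<subseteq> S" "\<And>b. g b 0 = (0::'c::comm_monoid_add)"
  shows "(\<Sum>b\<in>pkeys x. g b (plookup x b)) = (\<Sum>b\<in>S. g b (plookup x b))"
  by (rule sum.mono_neutral_left) (use assms in \<open>auto simp: in_keys_iff\<close>)

lemma sum_keys_add:
  fixes x y :: "'a \<Rightarrow>\<^sub>0 'b::comm_monoid_add"
  assumes "\<And>b. g b 0 = (0::'c::comm_monoid_add)" "\<And>b u v. g b (u + v) = g b u + g b v"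
  shows "(\<Sum>b\<in>pkeys (x + y). g b (plookup (x + y) b))
    = (\<Sum>b\<in>pkeys x. g b (plookup x b)) + (\<Sum>b\<in>pkeys y. g b (plookup y b))"
proof -
  let ?S = "pkeys x \<union> pkeys y"
  have "(\<Sum>b\<in>pkeys (x + y). g b (plookup (x + y) b)) = (\<Sum>b\<in>?S. g b (plookup (x + y) b))"
    by (rule sum_keys_superset) (auto simp: assms(1) dest: subsetD[OF keys_add])
  also have "\<dots> = (\<Sum>b\<in>?S. g b (plookup x b)) + (\<Sum>b\<in>?S. g b (plookup y b))"
    by (simp add: lookup_add assms(2) sum.distrib)
  also have "(\<Sum>b\<in>?S. g b (plookup x b)) = (\<Sum>b\<in>pkeys x. g b (plookup x b))"
    by (rule sum_keys_superset[symmetric]) (auto simp: assms(1))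
  also have "(\<Sum>b\<in>?S. g b (plookup y b)) = (\<Sum>b\<in>pkeys y. g b (plookup y b))"
    by (rule sum_keys_superset[symmetric]) (auto simp: assms(1))
  finally show ?thesis .
qed

lemma sum_keys_single:
  assumes "g b 0 = (0::'c::comm_monoid_add)"
  shows "(\<Sum>b'\<in>pkeys (psingle b u). g b' (plookup (psingle b u) b')) = g b u"
  by (cases "u = 0") (simp_all add: assms)

lemma ptensor_single: "ptensor \<alpha> (psingle b z) = psingle b (fscale z \<alpha>)"
  unfolding ptensor_def by (subst sum_keys_single) simp_all

lemma ptensor_zero_left: "ptensor 0 g = 0"
  by (simp add: ptensor_def)

lemma ptensor_zero_right [simp]: "ptensor \<alpha> 0 = 0"
  by (simp add: ptensor_def)

lemma base_form_eq: "base_form \<alpha> = psingle (0, 0) \<alpha>"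
  by (simp add: base_form_def gbasis_def ptensor_single)

lemma base_form_add: "base_form (\<alpha> + \<beta>) = base_form \<alpha> + base_form \<beta>"
  by (simp add: base_form_eq single_add)

lemma base_form_diff: "base_form (\<alpha> - \<beta>) = base_form \<alpha> - base_form \<beta>"
  by (simp add: base_form_eq single_diff)

lemma base_form_zero [simp]: "base_form 0 = 0"
  by (simp add: base_form_eq)

lemma base_form_sum: "base_form (sum f A) = (\<Sum>x\<in>A. base_form (f x))"
  by (induction A rule: infinite_finite_induct) (simp_all add: base_form_add)

lemma base_form_inject [simp]: "base_form \<alpha> = base_form \<beta> \<longleftrightarrow> \<alpha> = \<beta>"
  by (metis base_form_eq lookup_single_eq)

lemma lookup_pscale [simp]: "plookup (pscale z x) b = fscale z (plookup x b)"
  by (simp add: pscale_def Poly_Mapping.map.rep_eq when_def)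

lemma pscale_single: "pscale z (psingle b \<alpha>) = psingle b (fscale z \<alpha>)"
  by (rule poly_mapping_eqI) (simp add: lookup_single when_def)

lemma pscale_base_form: "pscale z (base_form \<alpha>) = base_form (fscale z \<alpha>)"
  by (simp add: base_form_eq pscale_single)

lemma pscale_add: "pscale z (x + y) = pscale z x + pscale z y"
  by (rule poly_mapping_eqI) (simp add: lookup_add fscale.scale_right_distrib)

lemma pscale_minus: "pscale z (- x) = - pscale z x"
  by (rule poly_mapping_eqI) simp

lemma pscale_diff: "pscale z (x - y) = pscale z x - pscale z y"
  using pscale_add[of z x "- y"] by (simp add: pscale_minus)

lemma fscale_vartheta [simp]: "fscale vartheta \<alpha> = \<alpha>"
  by (simp add: vartheta_def)

lemma vector_space_pscale: "vector_space (pscale :: complex \<Rightarrow> 'n::finite pform \<Rightarrow> 'n pform)"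
  by unfold_locales
     (rule poly_mapping_eqI; simp add: lookup_add fscale.scale_right_distrib fscale.scale_left_distrib)+

lemma gmult_basis: "gmult (gbasis a) (gbasis b) = psingle (a + b) (theta_z_sign (snd a) (fst b))"
  by (cases a; cases b) (simp add: gmult_def gbasis_def)

lemma gmult_zero_right [simp]: "gmult g 0 = 0"
  by (simp add: gmult_def)

lemma gmult_zero_left [simp]: "gmult 0 g = 0"
  by (simp add: gmult_def)

lemma gscale_single: "gscale z (psingle b w) = psingle b (z * w)"
  by (rule poly_mapping_eqI) (simp add: gscale_def Poly_Mapping.map.rep_eq lookup_single when_def)

lemma gscale_zero [simp]: "gscale z 0 = 0"
  by (rule poly_mapping_eqI) (simp add: gscale_def Poly_Mapping.map.rep_eq when_def)

lemma theta_z_sign_zero [simp]: "theta_z_sign k 0 = 1"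
  by (simp add: theta_z_sign_def)

lemma pmult_add_left: "pmult \<Xi> (x + y) w = pmult \<Xi> x w + pmult \<Xi> y w"
proof -
  have *: "pmult \<Xi> x w = (\<Sum>a\<in>pkeys x. (\<lambda>a u. \<Sum>b\<in>pkeys w. psingle (a + b) (fscale (theta_z_sign (snd a) (fst b))
      (fmult \<Xi> u (degree_sign (snd a) (plookup w b))))) a (plookup x a))" for x
    by (simp add: pmult_def gmult_basis ptensor_single)
  show ?thesis
    unfolding * by (rule sum_keys_add)
      (simp_all add: fmult_add_left fscale.scale_right_distrib single_add sum.distrib)
qed

lemma pmult_add_right: "pmult \<Xi> w (x + y) = pmult \<Xi> w x + pmult \<Xi> w y"
proof -
  have "(\<Sum>b\<in>pkeys (x + y). (\<lambda>b u. psingle (a + b) (fscale (theta_z_sign (snd a) (fst b))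
        (fmult \<Xi> v (degree_sign (snd a) u)))) b (plookup (x + y) b))
      = (\<Sum>b\<in>pkeys x. (\<lambda>b u. psingle (a + b) (fscale (theta_z_sign (snd a) (fst b))
        (fmult \<Xi> v (degree_sign (snd a) u)))) b (plookup x b))
      + (\<Sum>b\<in>pkeys y. (\<lambda>b u. psingle (a + b) (fscale (theta_z_sign (snd a) (fst b))
        (fmult \<Xi> v (degree_sign (snd a) u)))) b (plookup y b))" for a v
    by (rule sum_keys_add)
       (simp_all add: fmult_add_right degree_sign_add fscale.scale_right_distrib single_add)
  then show ?thesis
    by (simp add: pmult_def gmult_basis ptensor_single sum.distrib)
qed

lemma pmult_single:
  "pmult \<Xi> (psingle a \<alpha>) (psingle b \<beta>)
    = psingle (a + b) (fscale (theta_z_sign (snd a) (fst b)) (fmult \<Xi> \<alpha> (degree_sign (snd a) \<beta>)))"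
proof -
  have "pmult \<Xi> (psingle a \<alpha>) (psingle b \<beta>)
    = (\<Sum>a'\<in>pkeys (psingle a \<alpha>). \<Sum>b'\<in>pkeys (psingle b \<beta>).
        (\<lambda>b' v. psingle (a' + b') (fscale (theta_z_sign (snd a') (fst b'))
          (fmult \<Xi> (plookup (psingle a \<alpha>) a') (degree_sign (snd a') v)))) b' (plookup (psingle b \<beta>) b'))"
    by (simp add: pmult_def gmult_basis ptensor_single)
  also have "\<dots> = (\<Sum>a'\<in>pkeys (psingle a \<alpha>). (\<lambda>a' u. psingle (a' + b) (fscale (theta_z_sign (snd a') (fst b))
          (fmult \<Xi> u (degree_sign (snd a') \<beta>)))) a' (plookup (psingle a \<alpha>) a'))"
    by (subst sum_keys_single) simp_all
  also have "\<dots> = psingle (a + b) (fscale (theta_z_sign (snd a) (fst b)) (fmult \<Xi> \<alpha> (degree_sign (snd a) \<beta>)))"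
    by (subst sum_keys_single) simp_all
  finally show ?thesis .
qed

lemma pmult_base_form: "pmult \<Xi> (base_form \<alpha>) (base_form \<beta>) = base_form (fmult \<Xi> \<alpha> \<beta>)"
  by (simp add: base_form_eq pmult_single)

lemma pstar_base_form: "pstar \<Xi> (base_form \<alpha>) = base_form (fstar \<Xi> \<alpha>)"
proof -
  have "gstar (gbasis (0, 0)) = gbasis (0, 0)"
    by (simp add: gstar_def gbasis_def gmult_basis[unfolded gbasis_def] gscale_single numeral_2_eq_2)
  then show ?thesis
    by (cases "\<alpha> = 0") (simp_all add: pstar_def base_form_eq gbasis_def ptensor_single)
qed

lemma ppart_base_form: "ppart k (base_form \<alpha>) = base_form (form_part k \<alpha>)"
proof -
  let ?g = "\<lambda>(b :: gamma_index) (u :: 'a form). psingle b (\<chi> I. if card I + snd b = k then u $ I else 0) :: 'a pform"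
  have "(\<chi> I. if card I + snd b = k then 0 $ I else 0) = (0 :: 'a form)" for b :: gamma_index
    by (simp add: vec_eq_iff)
  then have "?g (0, 0) 0 = 0"
    by (metis single_zero)
  then have "ppart k (base_form \<alpha>) = ?g (0, 0) \<alpha>"
    unfolding ppart_def base_form_eq by (rule sum_keys_single)
  then show ?thesis
    by (simp add: base_form_eq form_part_def)
qed

lemma pdiff_eq:
  "pdiff x = (\<Sum>b\<in>pkeys x. (\<lambda>b u. ptensor (fdiff u) (gbasis b) + ptensor (degree_sign 1 u) (gdiff (gbasis b))) b (plookup x b))"
  by (simp add: pdiff_def)

lemma pdiff_add: "pdiff (x + y) = pdiff x + pdiff y"
proof -
  have tensor_add: "ptensor (u + v) g = ptensor u g + ptensor v g" for u v :: "'a form" and g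
    by (simp add: ptensor_def fscale.scale_right_distrib single_add sum.distrib)
  show ?thesis
    unfolding pdiff_eq by (rule sum_keys_add)
      (simp_all add: fdiff_add degree_sign_add tensor_add ptensor_zero_left)
qed

lemma pdiff_single:
  "pdiff (psingle b \<alpha>) = psingle b (fdiff \<alpha>) + ptensor (degree_sign 1 \<alpha>) (gdiff (gbasis b))"
  unfolding pdiff_eq by (subst sum_keys_single) (simp_all add: ptensor_zero_left gbasis_def ptensor_single)

lemma pdiff_base_form: "pdiff (base_form \<alpha>) = base_form (fdiff \<alpha>)"
proof -
  have "gdiff (gbasis (0, 0)) = 0"
    by (simp add: gdiff_def gbasis_def germ_def)
  then show ?thesis
    by (simp add: base_form_eq pdiff_single)
qed

lemma gdiff_theta: "gdiff (gbasis (0, 1)) = psingle (0, 2) (- 1)"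
  by (simp add: gdiff_def gbasis_def germ_def gscale_single gmult_def numeral_2_eq_2 flip: single_uminus)

section \<open>Horizontal intertwiners\<close>

definition base_map :: "'n::finite form \<Rightarrow> qu \<Rightarrow> 'n pform"
  where "base_map \<alpha> \<theta> = base_form (fscale \<theta> \<alpha>)"

lemma base_map_vartheta: "base_map \<alpha> vartheta = base_form \<alpha>"
  by (simp add: base_map_def vartheta_def)

lemma base_map_inject [simp]: "base_map \<alpha> = base_map \<beta> \<longleftrightarrow> \<alpha> = \<beta>"
  by (metis base_map_vartheta base_form_inject)

lemma conjugate_base_map: "conjugate_map \<Xi> (base_map \<alpha>) = base_map (fstar \<Xi> \<alpha>)"
  by (simp add: fun_eq_iff conjugate_map_def base_map_def pstar_base_form fstar_scale)

lemma pcoaction_eq: "pcoaction x = (\<Sum>b\<in>pkeys x. (\<lambda>b u. \<Sum>p\<in>pkeys (coprod_basis b).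
      psingle p (fscale (plookup (coprod_basis b) p) u)) b (plookup x b))"
  by (simp add: pcoaction_def)

lemma coprod_horizontal: "coprod_basis (m, 0) = psingle ((m, 0), (m, 0)) 1"
proof -
  have "gtensor 1 (gbasis a) (gbasis b) = psingle (a, b) 1" for a b
    by (simp add: gtensor_def gbasis_def)
  then show ?thesis
    by (simp add: coprod_basis_def gmult2_def gmult_basis gtensor_def)
qed

lemma qu_tensor_id_ad:
  assumes "T 0 = 0"
  shows "qu_tensor_id T (ad \<theta>) = (\<Sum>a\<in>pkeys (T \<theta>). psingle (a, (0, 0)) (plookup (T \<theta>) a))"
proof -
  have "ptensor_gamma x (gbasis (0, 0)) = (\<Sum>a\<in>pkeys x. psingle (a, (0, 0)) (plookup x a))" for x :: "'a pform"
    by (simp add: ptensor_gamma_def gbasis_def)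
  then show ?thesis
    by (cases "\<theta> = 0") (simp_all add: qu_tensor_id_def ad_def assms)
qed

lemma qu_linear_base_map: "qu_linear (base_map \<alpha>)"
  unfolding Vector_Spaces.linear_def
proof (intro conjI)
  show "vector_space ((*) :: complex \<Rightarrow> complex \<Rightarrow> complex)"
    by unfold_locales (simp_all add: algebra_simps)
  show "module_hom ((*) :: complex \<Rightarrow> complex \<Rightarrow> complex) pscale (base_map \<alpha>)"
    unfolding module_hom_def module_hom_axioms_def
    using vector_space_pscale
    by (auto simp: base_map_def base_form_add fscale.scale_left_distrib pscale_base_form
        vector_space_def module_def algebra_simps)
qed (rule vector_space_pscale)

text \<open>
  The coaction sends \<open>z\<^sup>m\<close> to \<open>z\<^sup>m \<otimes> z\<^sup>m\<close>, while the adjoint coaction requires the second factor to be \<open>1\<close>.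
  Comparing the coefficients at \<open>z\<^sup>m \<otimes> z\<^sup>m\<close> leaves only \<open>m = 0\<close>.
\<close>

lemma Mor_hor_iff: "T \<in> Mor_hor \<longleftrightarrow> (\<exists>\<alpha>. T = base_map \<alpha>)"
proof
  assume "\<exists>\<alpha>. T = base_map \<alpha>"
  then obtain \<alpha> where T: "T = base_map \<alpha>" ..
  have "pcoaction (T \<theta>) = qu_tensor_id T (ad \<theta>)" for \<theta>
    by (subst qu_tensor_id_ad)
       (auto simp: T base_map_def base_form_eq pcoaction_eq sum_keys_single coprod_horizontal)
  then show "T \<in> Mor_hor"
    using qu_linear_base_map[of \<alpha>]
    by (auto simp: Mor_hor_def T horizontal_def base_map_def base_form_eq split: if_splits)
next
  assume T: "T \<in> Mor_hor"
  then interpret Vector_Spaces.linear "(*)" pscale T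
    by (simp add: Mor_hor_def)
  let ?x = "T 1"
  have degree: "snd b = 0" if "b \<in> pkeys ?x" for b
    using T that by (auto simp: Mor_hor_def horizontal_def)
  have "plookup ?x b = 0" if b: "b \<noteq> (0, 0)" for b
  proof -
    have "pcoaction ?x = (\<Sum>a\<in>pkeys ?x. psingle (a, a) (plookup ?x a))"
      unfolding pcoaction_def
    proof (rule sum.cong[OF refl])
      fix a
      assume "a \<in> pkeys ?x"
      then have "a = (fst a, 0)"
        using degree by (simp add: prod_eq_iff)
      then have "coprod_basis a = psingle (a, a) 1"
        by (metis coprod_horizontal)
      then show "(\<Sum>p\<in>pkeys (coprod_basis a). psingle p (fscale (plookup (coprod_basis a) p) (plookup ?x a)))
          = psingle (a, a) (plookup ?x a)"
        by simp
    qed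
    then have "plookup (pcoaction ?x) (b, b) = (\<Sum>a\<in>pkeys ?x. if a = b then plookup ?x a else 0)"
      by (simp add: lookup_sum lookup_single when_def)
    also have "\<dots> = plookup ?x b"
      by (simp add: in_keys_iff)
    finally have "plookup ?x b = plookup (qu_tensor_id T (ad 1)) (b, b)"
      using T by (simp add: Mor_hor_def)
    also have "\<dots> = 0"
      using b by (subst qu_tensor_id_ad) (auto simp: zero lookup_sum lookup_single when_def)
    finally show ?thesis .
  qed
  then have "?x = base_form (plookup ?x (0, 0))"
    by (intro poly_mapping_eqI) (auto simp: base_form_eq lookup_single when_def)
  then have "T \<theta> = base_map (plookup ?x (0, 0)) \<theta>" for \<theta>
    using scale[of \<theta> 1] by (metis base_map_def mult.right_neutral pscale_base_form)
  then show "\<exists>\<alpha>. T = base_map \<alpha>"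
    by blast
qed

lemma Mor_bundle_iff: "T \<in> Mor_bundle \<longleftrightarrow> (\<exists>a. T = base_map (scalar_form a))"
proof
  assume T: "T \<in> Mor_bundle"
  then obtain \<alpha> where \<alpha>: "T = base_map \<alpha>"
    by (auto simp: Mor_bundle_def Mor_hor_iff)
  have "ppart 0 (T vartheta) = T vartheta"
    using T by (simp add: Mor_bundle_def)
  then have "form_part 0 \<alpha> = \<alpha>"
    by (simp add: \<alpha> base_map_vartheta ppart_base_form)
  moreover have "form_part 0 \<alpha> = scalar_form (\<alpha> $ {})"
    by (simp add: form_part_def vec_eq_iff)
  ultimately have "\<alpha> = scalar_form (\<alpha> $ {})"
    by simp
  then show "\<exists>a. T = base_map (scalar_form a)"
    using \<alpha> by metis
next
  assume "\<exists>a. T = base_map (scalar_form a)"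
  moreover have "form_part 0 (fscale \<theta> (scalar_form a)) = fscale \<theta> (scalar_form a)" for \<theta> and a :: "'a qtorus"
    by (simp add: form_part_def vec_eq_iff)
  ultimately show "T \<in> Mor_bundle"
    unfolding Mor_bundle_def using Mor_hor_iff by (auto simp: base_map_def ppart_base_form)
qed

section \<open>Curvature and covariant derivatives of connections\<close>

lemma canonical_connection_eq: "canonical_connection \<theta> = psingle (0, 1) (fscale \<theta> (scalar_form oneT))"
  by (simp add: canonical_connection_def qu_to_gamma_def ptensor_single)

definition connection_of :: "'n::finite form \<Rightarrow> qu \<Rightarrow> 'n pform"
  where "connection_of \<mu> \<theta> = canonical_connection \<theta> + base_map \<mu> \<theta>"

lemma connection_of_vartheta: "connection_of \<mu> vartheta = psingle (0, 1) (scalar_form oneT) + base_form \<mu>"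
  by (simp add: connection_of_def canonical_connection_eq base_map_vartheta)

text \<open>
  In the square of \<open>1 \<otimes> \<vartheta> + \<mu> \<otimes> 1\<close> the mixed terms cancel because \<open>\<vartheta>\<close> and \<open>\<mu>\<close> have degree \<open>1\<close> and anticommute. The
  square of \<open>\<vartheta>\<close> is cancelled by \<open>d \<vartheta> = - \<vartheta> \<vartheta>\<close>.
\<close>

lemma curvature_connection_of:
  assumes "homogeneous 1 \<mu>"
  shows "curvature \<Xi> (connection_of \<mu>) = base_map (fdiff \<mu> + fmult \<Xi> \<mu> \<mu>)"
proof
  fix \<theta>
  let ?F = "fmult \<Xi> \<mu> \<mu>"
  have "degree_sign 1 \<mu> = - \<mu>"
    using assms by (rule degree_sign_homogeneous_1)
  then have "pmult \<Xi> (connection_of \<mu> vartheta) (connection_of \<mu> vartheta)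
      = psingle (0, 2) (scalar_form oneT) + base_form ?F"
    by (simp add: connection_of_vartheta pmult_add_left pmult_add_right pmult_single base_form_eq
        single_uminus numeral_2_eq_2)
  moreover have "pdiff (connection_of \<mu> \<theta>)
      = psingle (0, 2) (- fscale \<theta> (scalar_form oneT)) + base_form (fscale \<theta> (fdiff \<mu>))"
    by (simp add: connection_of_def canonical_connection_eq base_map_def pdiff_add pdiff_base_form
        pdiff_single gdiff_theta[simplified] ptensor_single fdiff_scale degree_sign_scale)
  ultimately show "curvature \<Xi> (connection_of \<mu>) \<theta> = base_map (fdiff \<mu> + ?F) \<theta>"
    by (simp add: curvature_def bracket_def base_map_def base_form_add pscale_add pscale_diff pscale_minus pscale_base_form
        pscale_single fscale.scale_right_distrib single_uminus)
qed

lemma covariant_diff_add: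
  "covariant_diff \<Xi> \<mu> (\<alpha> + \<beta>) = covariant_diff \<Xi> \<mu> \<alpha> + covariant_diff \<Xi> \<mu> \<beta>"
  by (simp add: covariant_diff_def fdiff_add fmult_add_left fmult_add_right degree_sign_add)

lemma covariant_diff_zero: "covariant_diff \<Xi> \<mu> 0 = 0"
  by (simp add: covariant_diff_def)

lemma covariant_diff_sum: "covariant_diff \<Xi> \<mu> (sum f A) = (\<Sum>x\<in>A. covariant_diff \<Xi> \<mu> (f x))"
  by (induction A rule: infinite_finite_induct) (simp_all add: covariant_diff_add covariant_diff_zero)

text \<open>
  The embedded differential turns the brackets into a graded commutator. As \<open>\<vartheta>\<close> graded commutes with the
  forms of the base, the canonical part of the connection drops out in each degree and only \<open>\<mu>\<close> acts.
\<close>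

lemma DS_base_map: "DS \<Xi> (connection_of \<mu>) (base_map \<nu>) = base_map (covariant_diff \<Xi> \<mu> \<nu>)"
proof
  fix \<theta>
  have summand: "pdiff (ppart k (base_map \<nu> \<theta>)) - bracket \<Xi> (connection_of \<mu>) (\<lambda>\<eta>. ppart k (base_map \<nu> \<eta>)) \<theta>
      + pscale ((- 1) ^ k) (bracket \<Xi> (\<lambda>\<eta>. ppart k (base_map \<nu> \<eta>)) (connection_of \<mu>) \<theta>)
      = base_form (fscale \<theta> (covariant_diff \<Xi> \<mu> (form_part k \<nu>)))" for k
  proof -
    let ?\<alpha> = "form_part k \<nu>"
    have part: "ppart k (base_map \<nu> \<eta>) = base_form (fscale \<eta> ?\<alpha>)" for \<eta>
      by (simp add: base_map_def ppart_base_form) (simp add: form_part_def vec_eq_iff)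
    \<comment> \<open>passing \<open>\<vartheta>\<close> through a form of degree \<open>k\<close> costs the sign that occurs in the definition of \<open>DS\<close>\<close>
    have sign: "degree_sign (Suc 0) ?\<alpha> = fscale ((- 1) ^ k) ?\<alpha>"
      by (simp add: vec_eq_iff degree_sign_component form_part_def)
    have left: "pmult \<Xi> (connection_of \<mu> vartheta) (base_form ?\<alpha>)
        = psingle (0, 1) (fscale ((- 1) ^ k) ?\<alpha>) + base_form (fmult \<Xi> \<mu> ?\<alpha>)"
      using sign by (simp add: connection_of_vartheta pmult_add_left pmult_base_form)
        (simp add: base_form_eq pmult_single)
    have right: "pmult \<Xi> (base_form ?\<alpha>) (connection_of \<mu> vartheta)
        = psingle (0, 1) ?\<alpha> + base_form (fmult \<Xi> ?\<alpha> \<mu>)"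
      by (simp add: connection_of_vartheta pmult_add_right pmult_base_form) (simp add: base_form_eq pmult_single)
    show ?thesis
      unfolding bracket_def part fscale_vartheta left right
      by (simp add: pdiff_base_form fdiff_scale pscale_add pscale_diff pscale_minus pscale_single pscale_base_form
          covariant_diff_def sign fmult_scale_left fscale.scale_right_distrib fscale.scale_right_diff_distrib
          base_form_add base_form_diff mult.commute)
  qed
  have "DS \<Xi> (connection_of \<mu>) (base_map \<nu>) \<theta>
      = base_form (fscale \<theta> (covariant_diff \<Xi> \<mu> (\<Sum>k\<le>CARD('a). form_part k \<nu>)))"
    by (simp only: DS_def Let_def summand covariant_diff_sum fscale.scale_sum_right base_form_sum)
  then show "DS \<Xi> (connection_of \<mu>) (base_map \<nu>) \<theta> = base_map (covariant_diff \<Xi> \<mu> \<nu>) \<theta>"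
    by (simp add: form_part_sum base_map_def)
qed

lemma DS_hat_base_map:
  assumes "homogeneous 1 \<mu>" "fstar \<Xi> \<mu> = \<mu>"
  shows "DS_hat \<Xi> (connection_of \<mu>) (base_map \<nu>) = base_map (- covariant_diff \<Xi> \<mu> \<nu>)"
  by (simp add: DS_hat_def conjugate_base_map DS_base_map fstar_covariant_diff_star[OF assms])

section \<open>The balanced tensor product\<close>

text \<open>
  The element \<open>a\<close> of the quantum torus that represents the section \<open>\<vartheta> \<mapsto> a \<otimes> 1\<close> of \<open>E\<close>.
\<close>

definition section_coeff :: "(qu \<Rightarrow> 'n::finite pform) \<Rightarrow> 'n qtorus"
  where "section_coeff T = plookup (T vartheta) (0, 0) $ {}"

lemma section_coeff_base_map [simp]: "section_coeff (base_map (scalar_form a)) = a"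
  by (simp add: section_coeff_def base_map_vartheta base_form_eq)

lemma section_coeff: "T \<in> Mor_bundle \<Longrightarrow> T = base_map (scalar_form (section_coeff T))"
  by (auto simp: Mor_bundle_iff)

lemma base_map_scalar_in_Mor_bundle [simp]: "base_map (scalar_form a) \<in> Mor_bundle"
  by (auto simp: Mor_bundle_iff)

lemma Mor_bundle_add:
  assumes "S \<in> Mor_bundle" "T \<in> Mor_bundle"
  shows "(\<lambda>\<theta>. S \<theta> + T \<theta>) = base_map (scalar_form (section_coeff S + section_coeff T))"
proof -
  have "S \<theta> + T \<theta> = base_map (scalar_form (section_coeff S + section_coeff T)) \<theta>" for \<theta>
    by (subst section_coeff[OF assms(1)], subst section_coeff[OF assms(2)])
       (simp add: base_map_def scalar_form_add fscale.scale_right_distrib base_form_add)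
  then show ?thesis ..
qed

lemma Mor_bundle_mult:
  assumes "T \<in> Mor_bundle"
  shows "(\<lambda>\<theta>. pmult \<Xi> (T \<theta>) (base_form (scalar_form a))) = base_map (scalar_form (multT \<Xi> (section_coeff T) a))"
proof -
  have "pmult \<Xi> (T \<theta>) (base_form (scalar_form a)) = base_map (scalar_form (multT \<Xi> (section_coeff T) a)) \<theta>" for \<theta>
    by (subst section_coeff[OF assms])
       (simp add: base_map_def pmult_base_form fmult_scale_left fmult_scalar_scalar)
  then show ?thesis ..
qed

text \<open>
  On formal sums of pairs, this is the map induced by \<open>T \<otimes> \<nu> \<mapsto> T(\<vartheta>) \<nu>\<close>. It is the invariant by which
  classes in the tensor product are told apart.
\<close>

definition contract :: "'n::{finite,linorder} rmatrix \<Rightarrow> ((qu \<Rightarrow> 'n pform) \<times> 'n form \<Rightarrow>\<^sub>0 int) \<Rightarrow> 'n form"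
  where "contract \<Xi> x = (\<Sum>(T, \<nu>)\<in>pkeys x.
    fscale (of_int (plookup x (T, \<nu>))) (fmult \<Xi> (scalar_form (section_coeff T)) \<nu>))"

lemma contract_eq:
  "contract \<Xi> x = (\<Sum>p\<in>pkeys x. (\<lambda>p n. fscale (of_int n) (fmult \<Xi> (scalar_form (section_coeff (fst p))) (snd p)))
    p (plookup x p))"
  by (simp add: contract_def case_prod_unfold)

lemma contract_add: "contract \<Xi> (x + y) = contract \<Xi> x + contract \<Xi> y"
  unfolding contract_eq by (rule sum_keys_add) (simp_all add: fscale.scale_left_distrib)

lemma contract_zero [simp]: "contract \<Xi> 0 = 0"
  by (simp add: contract_def)

lemma contract_minus: "contract \<Xi> (- x) = - contract \<Xi> x"
  using contract_add[of \<Xi> x "- x"] by (simp add: add_eq_0_iff)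

lemma contract_diff: "contract \<Xi> (x - y) = contract \<Xi> x - contract \<Xi> y"
  using contract_add[of \<Xi> x "- y"] by (simp add: contract_minus)

lemma contract_frag_of: "contract \<Xi> (frag_of (T, \<nu>)) = fmult \<Xi> (scalar_form (section_coeff T)) \<nu>"
  unfolding contract_eq by (subst sum_keys_single) simp_all

abbreviation relations where "relations \<Xi> \<equiv> generate pairs_group (tensor_relators \<Xi>)"

lemma tensor_relators_closed: "tensor_relators \<Xi> \<subseteq> carrier pairs_group"
proof
  fix r
  assume "r \<in> tensor_relators \<Xi>"
  then show "r \<in> carrier pairs_group"
    unfolding tensor_relators_def
    by (elim UnE CollectE exE conjE; hypsubst)
       (simp_all add: Mor_bundle_add Mor_bundle_mult,
        (intro order_trans[OF keys_diff] Un_least; simp)+)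
qed

lemma contract_relator: "r \<in> tensor_relators \<Xi> \<Longrightarrow> contract \<Xi> r = 0"
  unfolding tensor_relators_def
  by (elim UnE CollectE exE conjE; hypsubst)
     (simp_all add: contract_diff contract_frag_of Mor_bundle_add Mor_bundle_mult fmult_add_right,
      simp_all add: scalar_form_add fmult_add_left fmult_assoc flip: fmult_scalar_scalar)

lemma subgroup_relations: "subgroup (relations \<Xi>) pairs_group"
  by (rule group.generate_is_subgroup[OF group_free_Abelian_group tensor_relators_closed])

lemma contract_relation: "h \<in> relations \<Xi> \<Longrightarrow> contract \<Xi> h = 0"
proof (induction rule: generate.induct)
  case (inv h)
  then have "h \<in> carrier pairs_group"
    using tensor_relators_closed by blast
  then show ?case
    using inv by (simp add: contract_minus contract_relator)
qed (simp_all add: contract_relator contract_add)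

lemma relations_add: "x \<in> relations \<Xi> \<Longrightarrow> y \<in> relations \<Xi> \<Longrightarrow> x + y \<in> relations \<Xi>"
  using subgroup.m_closed[OF subgroup_relations, of x \<Xi> y] by simp

lemma relations_minus: "x \<in> relations \<Xi> \<Longrightarrow> - x \<in> relations \<Xi>"
  using subgroup.m_inv_closed[OF subgroup_relations, of x \<Xi>] subgroup.subset[OF subgroup_relations, of \<Xi>] by auto

lemma relations_diff: "x \<in> relations \<Xi> \<Longrightarrow> y \<in> relations \<Xi> \<Longrightarrow> x - y \<in> relations \<Xi>"
  using relations_add[OF _ relations_minus, of x \<Xi> y] by simp

definition unit_section :: "qu \<Rightarrow> 'n::finite pform"
  where "unit_section = base_map (scalar_form oneT)"

lemma unit_section_in_Mor_bundle [simp]: "unit_section \<in> Mor_bundle"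
  by (simp add: unit_section_def)

lemma contract_unit [simp]: "contract \<Xi> (frag_of (unit_section, \<nu>)) = \<nu>"
  by (simp add: contract_frag_of unit_section_def)

lemma unit_section_additive:
  "frag_of (unit_section, \<mu> + \<nu>) - frag_of (unit_section, \<mu>) - frag_of (unit_section, \<nu>) \<in> relations \<Xi>"
  by (rule generate.incl) (use unit_section_in_Mor_bundle in \<open>unfold tensor_relators_def, blast\<close>)

text \<open>
  The module \<open>E\<close> is free on the section \<open>\<vartheta> \<mapsto> 1 \<otimes> 1\<close>. Hence the balancing relation moves every coefficient to
  the form, \<open>T \<otimes> \<nu> = 1 \<otimes> a \<nu>\<close>, and additivity collects a formal sum into a single tensor.
\<close>

lemma normal_form:
  assumes "x \<in> carrier pairs_group"
  shows "x - frag_of (unit_section, contract \<Xi> x) \<in> relations \<Xi>"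
proof -
  have "pkeys x \<subseteq> Mor_bundle \<times> UNIV"
    using assms by simp
  then show ?thesis
  proof (induction x rule: frag_induction)
    case zero
    \<comment> \<open>the additivity relator for \<open>0 + 0\<close> is the negative of the pair with form \<open>0\<close>\<close>
    show ?case
      using relations_minus[OF relations_minus[OF unit_section_additive[of 0 0 \<Xi>]]] by simp
  next
    case (one p)
    obtain T \<nu> where p: "p = (T, \<nu>)" and T: "T \<in> Mor_bundle"
      using one by auto
    let ?a = "section_coeff T"
    have "frag_of (\<lambda>\<theta>. pmult \<Xi> (unit_section \<theta>) (base_form (scalar_form ?a)), \<nu>)
        - frag_of (unit_section, fmult \<Xi> (scalar_form ?a) \<nu>) \<in> tensor_relators \<Xi>"
      unfolding tensor_relators_def using unit_section_in_Mor_bundle by blast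
    moreover have "(\<lambda>\<theta>. pmult \<Xi> (unit_section \<theta>) (base_form (scalar_form ?a))) = T"
      using section_coeff[OF T] by (subst Mor_bundle_mult) (simp_all add: unit_section_def)
    ultimately have "frag_of (T, \<nu>) - frag_of (unit_section, fmult \<Xi> (scalar_form ?a) \<nu>) \<in> tensor_relators \<Xi>"
      by simp
    then show ?case
      by (simp add: p contract_frag_of generate.incl)
  next
    case (diff x y)
    let ?u = "\<lambda>\<nu>. frag_of (unit_section, \<nu>)"
    \<comment> \<open>additivity is applied to the decomposition of the form of \<open>x\<close> as (difference) + (form of \<open>y\<close>)\<close>
    have "(x - ?u (contract \<Xi> x)) - (y - ?u (contract \<Xi> y))
        + (?u ((contract \<Xi> x - contract \<Xi> y) + contract \<Xi> y) - ?u (contract \<Xi> x - contract \<Xi> y) - ?u (contract \<Xi> y))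
        \<in> relations \<Xi>"
      by (intro relations_add relations_diff diff unit_section_additive)
    then show ?case
      by (simp add: contract_diff)
  qed
qed

text \<open>
  The class of \<open>1 \<otimes> \<nu>\<close>.
\<close>

definition pure_tensor :: "'n::{finite,linorder} rmatrix \<Rightarrow> 'n form \<Rightarrow> 'n tensor"
  where "pure_tensor \<Xi> \<nu> = relations \<Xi> #>\<^bsub>pairs_group\<^esub> frag_of (unit_section, \<nu>)"

lemma mem_coset_iff: "y \<in> relations \<Xi> #>\<^bsub>pairs_group\<^esub> x \<longleftrightarrow> y - x \<in> relations \<Xi>"
  unfolding r_coset_def by force

lemma coset_eq:
  assumes "x - y \<in> relations \<Xi>"
  shows "relations \<Xi> #>\<^bsub>pairs_group\<^esub> x = relations \<Xi> #>\<^bsub>pairs_group\<^esub> y"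
proof (rule Set.set_eqI)
  fix z
  have "z - y = (z - x) + (x - y)" "z - x = (z - y) - (x - y)"
    by simp_all
  then show "z \<in> relations \<Xi> #>\<^bsub>pairs_group\<^esub> x \<longleftrightarrow> z \<in> relations \<Xi> #>\<^bsub>pairs_group\<^esub> y"
    unfolding mem_coset_iff using assms relations_add relations_diff by metis
qed

lemma carrier_tensor_group: "carrier (tensor_group \<Xi>) = range (pure_tensor \<Xi>)"
proof
  show "carrier (tensor_group \<Xi>) \<subseteq> range (pure_tensor \<Xi>)"
  proof
    fix X
    assume "X \<in> carrier (tensor_group \<Xi>)"
    then obtain x where x: "x \<in> carrier pairs_group" and X: "X = relations \<Xi> #>\<^bsub>pairs_group\<^esub> x"
      by (auto simp: tensor_group_def FactGroup_def RCOSETS_def)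
    have "X = pure_tensor \<Xi> (contract \<Xi> x)"
      unfolding X pure_tensor_def by (rule coset_eq[OF normal_form[OF x]])
    then show "X \<in> range (pure_tensor \<Xi>)"
      by blast
  qed
  have "frag_of (unit_section, \<nu>) \<in> carrier pairs_group" for \<nu> :: "'a form"
    by simp
  then show "range (pure_tensor \<Xi>) \<subseteq> carrier (tensor_group \<Xi>)"
    unfolding tensor_group_def FactGroup_def RCOSETS_def pure_tensor_def by fastforce
qed

lemma one_tensor_group: "\<one>\<^bsub>tensor_group \<Xi>\<^esub> = pure_tensor \<Xi> 0"
proof -
  have "frag_of (unit_section, 0) - 0 \<in> relations \<Xi>"
    using relations_minus[OF unit_section_additive[of 0 0 \<Xi>]] by simp
  then have "pure_tensor \<Xi> 0 = relations \<Xi> #>\<^bsub>pairs_group\<^esub> 0"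
    unfolding pure_tensor_def by (rule coset_eq)
  also have "\<dots> = relations \<Xi>"
    by (simp add: set_eq_iff mem_coset_iff)
  finally show ?thesis
    by (simp add: tensor_group_def FactGroup_def)
qed

text \<open>
  As contraction kills the relations, all representatives of a class contract to the same form, whichever
  of them is chosen.
\<close>

lemma representative_pure_tensor:
  "pkeys (representative (pure_tensor \<Xi> \<nu>)) \<subseteq> Mor_bundle \<times> UNIV"
  "contract \<Xi> (representative (pure_tensor \<Xi> \<nu>)) = \<nu>"
proof -
  let ?x = "representative (pure_tensor \<Xi> \<nu>)" and ?u = "frag_of (unit_section, \<nu>)"
  have "?u \<in> pure_tensor \<Xi> \<nu>"
    using relations_diff[OF unit_section_additive[of 0 0 \<Xi>] unit_section_additive[of 0 0 \<Xi>]]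
    by (simp add: pure_tensor_def mem_coset_iff)
  then have "?x \<in> pure_tensor \<Xi> \<nu>"
    unfolding representative_def by (rule someI)
  then have r: "?x - ?u \<in> relations \<Xi>"
    by (simp add: pure_tensor_def mem_coset_iff)
  then have "?x - ?u \<in> carrier pairs_group"
    by (rule subgroup.mem_carrier[OF subgroup_relations])
  moreover have "?u \<in> carrier pairs_group"
    by simp
  ultimately have "(?x - ?u) \<otimes>\<^bsub>pairs_group\<^esub> ?u \<in> carrier pairs_group"
    by (intro monoid.m_closed group.is_monoid group_free_Abelian_group)
  then show "pkeys ?x \<subseteq> Mor_bundle \<times> UNIV"
    by simp
  show "contract \<Xi> ?x = \<nu>"
    using contract_relation[OF r] by (simp add: contract_diff)
qed

lemma pure_tensor_inject [simp]: "pure_tensor \<Xi> \<mu> = pure_tensor \<Xi> \<nu> \<longleftrightarrow> \<mu> = \<nu>"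
  by (metis representative_pure_tensor(2))

lemma Upsilon_inv_pure_tensor: "Upsilon_inv \<Xi> (pure_tensor \<Xi> \<nu>) = base_map \<nu>"
proof
  fix \<theta>
  let ?x = "representative (pure_tensor \<Xi> \<nu>)"
  have "pscale z (pmult \<Xi> (T \<theta>) (base_form \<alpha>)) = base_form (fscale \<theta> (fscale z (fmult \<Xi> (scalar_form (section_coeff T)) \<alpha>)))"
    if "T \<in> Mor_bundle" for T z \<alpha>
    by (subst section_coeff[OF that])
       (simp add: base_map_def pmult_base_form fmult_scale_left pscale_base_form mult.commute)
  then have "Upsilon_inv \<Xi> (pure_tensor \<Xi> \<nu>) \<theta> = (\<Sum>(T, \<alpha>)\<in>pkeys ?x.
      base_form (fscale \<theta> (fscale (of_int (plookup ?x (T, \<alpha>))) (fmult \<Xi> (scalar_form (section_coeff T)) \<alpha>))))"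
    unfolding Upsilon_inv_def Let_def using representative_pure_tensor(1)[of \<Xi> \<nu>]
    by (intro sum.cong) auto
  also have "\<dots> = base_form (fscale \<theta> (contract \<Xi> ?x))"
    by (simp add: contract_def base_form_sum fscale.scale_sum_right case_prod_unfold)
  finally show "Upsilon_inv \<Xi> (pure_tensor \<Xi> \<nu>) \<theta> = base_map \<nu> \<theta>"
    by (simp add: representative_pure_tensor(2) base_map_def)
qed

lemma Upsilon_base_map: "Upsilon \<Xi> (base_map \<nu>) = pure_tensor \<Xi> \<nu>"
proof -
  have "inj_on (Upsilon_inv \<Xi>) (carrier (tensor_group \<Xi>))"
    by (auto simp: inj_on_def carrier_tensor_group Upsilon_inv_pure_tensor)
  then show ?thesis
    unfolding Upsilon_def by (metis Upsilon_inv_pure_tensor carrier_tensor_group inv_into_f_f rangeI)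
qed

lemma hermitian_base_map:
  "hermitian \<Xi> (base_map (scalar_form a)) (base_map (scalar_form b)) = multT \<Xi> (starT \<Xi> a) b"
proof -
  have "scalar_form x = scalar_form y \<longleftrightarrow> x = y" for x y :: "'a qtorus"
    by (auto simp: vec_eq_iff)
  then show ?thesis
    by (simp add: hermitian_def base_map_vartheta pstar_base_form fstar_scalar pmult_base_form fmult_scalar_scalar)
qed

text \<open>
  The sesquilinear sum over the representatives collapses, since each summand only sees the contraction of
  its two tensors.
\<close>

lemma tensor_inner_pure_tensor:
  "tensor_inner c \<Xi> (pure_tensor \<Xi> \<alpha>) (pure_tensor \<Xi> \<beta>) = form_inner c \<Xi> \<alpha> \<beta>"
proof -
  let ?x = "representative (pure_tensor \<Xi> \<alpha>)" and ?y = "representative (pure_tensor \<Xi> \<beta>)"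
  let ?c = "\<lambda>T. scalar_form (section_coeff T)"
  have pair: "form_inner c \<Xi> \<mu> (fmult \<Xi> (scalar_form (hermitian \<Xi> S T)) \<nu>)
      = form_inner c \<Xi> (fmult \<Xi> (?c S) \<mu>) (fmult \<Xi> (?c T) \<nu>)"
    if "S \<in> Mor_bundle" "T \<in> Mor_bundle" for S T \<mu> \<nu>
    by (subst section_coeff[OF that(1)], subst section_coeff[OF that(2)])
       (simp add: hermitian_base_map form_inner_scalar)
  have "tensor_inner c \<Xi> (pure_tensor \<Xi> \<alpha>) (pure_tensor \<Xi> \<beta>)
      = (\<Sum>p\<in>pkeys ?x. \<Sum>q\<in>pkeys ?y. of_int (plookup ?x p * plookup ?y q)
          * form_inner c \<Xi> (fmult \<Xi> (?c (fst p)) (snd p)) (fmult \<Xi> (?c (fst q)) (snd q)))"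
    unfolding tensor_inner_def Let_def case_prod_unfold
    using representative_pure_tensor(1)[of \<Xi> \<alpha>] representative_pure_tensor(1)[of \<Xi> \<beta>]
    by (intro sum.cong refl, subst pair) auto
  also have "\<dots> = form_inner c \<Xi> (contract \<Xi> ?x) (contract \<Xi> ?y)"
    unfolding contract_eq form_inner_sum_left unfolding form_inner_sum_right
    by (simp add: form_inner_scale_left form_inner_scale_right mult_ac)
  finally show ?thesis
    by (simp add: representative_pure_tensor(2))
qed

section \<open>The formal adjoint at the curvature\<close>

lemma exterior_DS_hat_pure_tensor:
  assumes "homogeneous 1 \<mu>" "fstar \<Xi> \<mu> = \<mu>"
  shows "exterior_DS_hat \<Xi> (connection_of \<mu>) (pure_tensor \<Xi> \<nu>) = pure_tensor \<Xi> (- covariant_diff \<Xi> \<mu> \<nu>)"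
  by (simp add: exterior_DS_hat_def Upsilon_inv_pure_tensor DS_hat_base_map[OF assms] Upsilon_base_map)

text \<open>
  The minus sign of the operator and the one of \<open>F\<^sup>* = - F\<close> cancel.
\<close>

lemma form_inner_curvature:
  fixes \<mu> \<nu> :: "'n::{finite,linorder} form"
  assumes "CARD('n) \<ge> 2" "homogeneous 1 \<mu>" "fstar \<Xi> \<mu> = \<mu>"
  shows "form_inner c \<Xi> (fdiff \<mu> + fmult \<Xi> \<mu> \<mu>) (- covariant_diff \<Xi> \<mu> \<nu>)
    = of_real c * top_trace (fmult \<Xi> \<nu> (yang_mills_form \<Xi> \<mu>))"
  using top_trace_covariant_diff[OF assms(1,2), of \<Xi> \<nu>]
  by (simp only: form_inner_eq_top_trace fstar_curvature[OF assms(2,3)] hodge_minus fmult_minus_left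
      fmult_minus_right minus_minus)

text \<open>
  Since the Hodge operator and the involution are bijective, a form \<open>\<zeta>\<close> with \<open>\<star>(\<zeta>\<^sup>*)\<close> equal to the Yang--Mills form
  exists. Integration by parts shows that its class satisfies the defining property of the adjoint, and
  nondegeneracy of the integral shows that no other class does. So the adjoint vanishes exactly when \<open>\<zeta>\<close> does.
\<close>

lemma formal_adjoint_curvature_eq_one_iff:
  fixes \<mu> :: "'n::{finite,linorder} form"
  assumes "CARD('n) \<ge> 2" "c > 0" "homogeneous 1 \<mu>" "fstar \<Xi> \<mu> = \<mu>"
  shows "formal_adjoint c \<Xi> (exterior_DS_hat \<Xi> (connection_of \<mu>))
      (Upsilon \<Xi> (curvature \<Xi> (connection_of \<mu>))) = \<one>\<^bsub>tensor_group \<Xi>\<^esub> \<longleftrightarrow> yang_mills_form \<Xi> \<mu> = 0"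
proof -
  let ?W = "yang_mills_form \<Xi> \<mu>" and ?X = "Upsilon \<Xi> (curvature \<Xi> (connection_of \<mu>))"
  let ?D = "exterior_DS_hat \<Xi> (connection_of \<mu>)"
  obtain \<beta> where "hodge \<beta> = ?W"
    by (rule hodge_surjective)
  then obtain \<zeta> where \<zeta>: "hodge (fstar \<Xi> \<zeta>) = ?W"
    by (metis fstar_star)
  have adjoint_iff: "(\<forall>Y\<in>carrier (tensor_group \<Xi>). tensor_inner c \<Xi> (pure_tensor \<Xi> \<alpha>) Y = tensor_inner c \<Xi> ?X (?D Y))
      \<longleftrightarrow> \<alpha> = \<zeta>" for \<alpha>
  proof -
    have "tensor_inner c \<Xi> (pure_tensor \<Xi> \<alpha>) (pure_tensor \<Xi> \<nu>) = tensor_inner c \<Xi> ?X (?D (pure_tensor \<Xi> \<nu>))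
        \<longleftrightarrow> top_trace (fmult \<Xi> \<nu> (hodge (fstar \<Xi> (\<alpha> - \<zeta>)))) = 0" for \<nu>
      using assms(2)
      by (simp add: curvature_connection_of[OF assms(3)] Upsilon_base_map exterior_DS_hat_pure_tensor[OF assms(3,4)]
          tensor_inner_pure_tensor form_inner_curvature[OF assms(1,3,4)]) (simp add: form_inner_eq_top_trace fstar_diff hodge_diff fmult_diff_right top_trace_diff \<zeta>)
    then have "(\<forall>Y\<in>carrier (tensor_group \<Xi>). tensor_inner c \<Xi> (pure_tensor \<Xi> \<alpha>) Y = tensor_inner c \<Xi> ?X (?D Y))
        \<longleftrightarrow> (\<forall>\<nu>. top_trace (fmult \<Xi> \<nu> (hodge (fstar \<Xi> (\<alpha> - \<zeta>)))) = 0)"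
      by (simp add: carrier_tensor_group)
    also have "\<dots> \<longleftrightarrow> hodge (fstar \<Xi> (\<alpha> - \<zeta>)) = 0"
      using top_trace_nondegenerate[of \<Xi> "hodge (fstar \<Xi> (\<alpha> - \<zeta>))"] by (auto simp: top_trace_def)
    also have "\<dots> \<longleftrightarrow> \<alpha> = \<zeta>"
      by (simp add: hodge_eq_0_iff)
    finally show ?thesis .
  qed
  have "formal_adjoint c \<Xi> ?D ?X = pure_tensor \<Xi> \<zeta>"
    unfolding formal_adjoint_def
  proof (rule the_equality)
    show "pure_tensor \<Xi> \<zeta> \<in> carrier (tensor_group \<Xi>) \<and>
        (\<forall>Y\<in>carrier (tensor_group \<Xi>). tensor_inner c \<Xi> (pure_tensor \<Xi> \<zeta>) Y = tensor_inner c \<Xi> ?X (?D Y))"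
      using adjoint_iff[of \<zeta>] by (simp add: carrier_tensor_group)
  next
    fix Z
    assume Z: "Z \<in> carrier (tensor_group \<Xi>) \<and>
        (\<forall>Y\<in>carrier (tensor_group \<Xi>). tensor_inner c \<Xi> Z Y = tensor_inner c \<Xi> ?X (?D Y))"
    then obtain \<alpha> where "Z = pure_tensor \<Xi> \<alpha>"
      by (auto simp: carrier_tensor_group)
    then show "Z = pure_tensor \<Xi> \<zeta>"
      using Z adjoint_iff[of \<alpha>] by simp
  qed
  moreover have "\<zeta> = 0 \<longleftrightarrow> ?W = 0"
    unfolding \<zeta>[symmetric] by (simp add: hodge_eq_0_iff)
  ultimately show ?thesis
    by (simp add: one_tensor_group)
qed

theorem theorem6p13:
  fixes \<Xi> :: "'n::{finite,linorder} rmatrix"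
    and c :: real
    and \<omega> lam :: "qu \<Rightarrow> 'n pform"
    and \<mu> :: "'n form"
  assumes "CARD('n) \<ge> 2"
    and "transpose \<Xi> = - \<Xi>"
    and "c > 0"
    and "connection \<Xi> \<omega>"
    and "\<omega> \<noteq> canonical_connection"
    and "\<omega> = (\<lambda>\<theta>. canonical_connection \<theta> + lam \<theta>)"
    and "qu_linear lam"
    and "lam vartheta = base_form \<mu>"
    and "form_part 1 \<mu> = \<mu>"
    and "fstar \<Xi> \<mu> = \<mu>"
  shows "yang_mills c \<Xi> \<omega> \<longleftrightarrow>
    fdiff (hodge (fdiff \<mu> + fmult \<Xi> \<mu> \<mu>))
      + fmult \<Xi> \<mu> (hodge (fdiff \<mu> + fmult \<Xi> \<mu> \<mu>))
      + fscale ((- 1) ^ (CARD('n) - 1)) (fmult \<Xi> (hodge (fdiff \<mu> + fmult \<Xi> \<mu> \<mu>)) \<mu>) = 0"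
proof -
  interpret lam: Vector_Spaces.linear "(*)" pscale lam
    by (rule assms(7))
  have "lam \<theta> = base_map \<mu> \<theta>" for \<theta>
  proof -
    have "lam (\<theta> * vartheta) = base_map \<mu> \<theta>"
      unfolding lam.scale by (simp only: assms(8) base_map_def pscale_base_form)
    then show ?thesis
      by (simp add: vartheta_def)
  qed
  then have \<omega>: "\<omega> = connection_of \<mu>"
    by (simp add: assms(6) connection_of_def fun_eq_iff)
  have "homogeneous 1 \<mu>"
    using assms(9) by (simp add: homogeneous_iff)
  then have "yang_mills c \<Xi> \<omega> \<longleftrightarrow> yang_mills_form \<Xi> \<mu> = 0"
    using assms(4) formal_adjoint_curvature_eq_one_iff[OF assms(1,3) _ assms(10)]
    unfolding \<omega> by (simp add: yang_mills_def)
  then show ?thesis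
    by (simp only: yang_mills_form_def Let_def)
qed

end
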